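(* Let $\hat{\mathbf H}(s)=\mathbf I_N\otimes \mathbf H(s)$ with $\mathbf H(s)=(s\mathbf I_n-\mathbf A)^{-1}\mathbf B\mathbf K$, let $\hat{\mathbf L}=c(\mathbf L\otimes \mathbf I_n)$, and let $\lambda_1=0,\lambda_2,\dots,\lambda_N$ be the eigenvalues of the graph Laplacian $\mathbf L$. If $\hat{\mathbf H}(s)\hat{\mathbf L}$ has $p_u$ unstable poles, then the closed-loop system $$\dot{\mathbf x}(t)=(\mathbf I_N\otimes \mathbf A)\mathbf x(t)-c(\mathbf L\otimes \mathbf B\mathbf K)\mathbf x(t)$$ is stable if and only if any of the following two statements holds: (1) the Nyquist plot of $\det[\mathbf I_{nN}+\hat{\mathbf H}(s)\hat{\mathbf L}]$ makes $p_u$ anti-clockwise encirclements of the origin; (2) the Nyquist plot of $\prod_{p=2}^{N}\det[\mathbf I_n+c\lambda_p\mathbf H(s)]$ makes $p_u$ anti-clockwise encirclements of the origin.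
   Context: Graph: $\mathcal G$ is a weighted directed graph on nodes $\{1,\dots,N\}$ with adjacency matrix $[a_{ik}]$, $a_{ik}>0$ if $(k,i)$ is an edge and $a_{ik}=0$ otherwise; $\mathcal N_i$ is the set of neighbors of $i$, i.e. of $k$ with $(k,i)$ an edge. The Laplacian $\mathbf L=[l_{ik}]$ has $l_{ii}=\sum_{k\ne i}a_{ik}$ and $l_{ik}=-a_{ik}$ for $i\ne k$. Throughout, the graph is strongly connected with at least one directed spanning tree; consequently $\lambda_1=0$ is a simple eigenvalue of $\mathbf L$ and all other eigenvalues $\lambda_2,\dots,\lambda_N$ have positive real part. Agents: $\dot{\mathbf x}_i=\mathbf A\mathbf x_i+\mathbf B\mathbf u_i$, $i=1,\dots,N$, with $\mathbf A\in\mathbb R^{n\times n}$, $\mathbf B\in\mathbb R^{n\times m}$, $(\mathbf A,\mathbf B)$ stabilizable; $\mathbf K\in\mathbb R^{m\times n}$ is such that $\mathbf A-\mathbf B\mathbf K$ is Hurwitz; the control is $\mathbf u_i=c\mathbf K\sum_{k\in\mathcal N_i}a_{ik}(\mathbf x_k-\mathbf x_i)$ with scalar coupling gain $c$. The global state is $\mathbf x=[\mathbf x_1^T,\dots,\mathbf x_N^T]^T\in\mathbb R^{Nn}$, and $\hat{\mathbf H}(s)\hat{\mathbf L}$ is the overall loop transfer function. Stability of the multi-agent closed-loop system is meant in the sense relevant to consensus (the mode associated with $\lambda_1=0$ is not considered): it amounts to stability of the $N-1$ systems $\dot{\boldsymbol\xi}_p=(\mathbf A-c\lambda_p\mathbf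 B\mathbf K)\boldsymbol\xi_p$, $p=2,\dots,N$. The Nyquist plot is the image of the standard Nyquist contour enclosing the right half-plane; an unstable pole is a pole in the right half-plane.
   Formalization: The coupling gain c is assumed nonzero (for c = 0 and A not Hurwitz both plots are constant and p_u = 0, yet the system is not stable); poles on the imaginary axis count as unstable, with the Nyquist contour indented to their left. *)

theory Defs
  imports
    "HOL-Complex_Analysis.Complex_Analysis"
    "Graph_Theory.Graph_Theory"
    "Jordan_Normal_Form.Gauss_Jordan_Elimination"
    "Jordan_Normal_Form.Char_Poly"
    "Jordan_Normal_Form.DL_Submatrix"
begin

unbundle no vec_syntax

hide_const (open) Finite_Cartesian_Product.vec Finite_Cartesian_Product.row
  Finite_Cartesian_Product.column Finite_Cartesian_Product.mat Determinants.det

text \<open>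
  Matrices are those of Jordan_Normal_Form, indexed from 0, so the \<^term>\<open>N\<close> nodes of the graph are
  \<^term>\<open>{..<N}\<close>.
\<close>

abbreviation cmat :: "real mat \<Rightarrow> complex mat" where
  "cmat \<equiv> map_mat complex_of_real"

definition kron :: "'a::semiring_0 mat \<Rightarrow> 'a mat \<Rightarrow> 'a mat" where
  "kron P Q = Matrix.mat (dim_row P * dim_row Q) (dim_col P * dim_col Q)
     (\<lambda>(i, j). P $$ (i div dim_row Q, j div dim_col Q) * Q $$ (i mod dim_row Q, j mod dim_col Q))"

text \<open>Totalised by 0 on singular matrices, like \<^const>\<open>inverse\<close> on fields.\<close>

definition mat_inv :: "'a::field mat \<Rightarrow> 'a mat" where
  "mat_inv M = (case mat_inverse M of Some X \<Rightarrow> X | None \<Rightarrow> 0\<^sub>m (dim_row M) (dim_row M))"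

definition hurwitz :: "complex mat \<Rightarrow> bool" where
  "hurwitz M \<longleftrightarrow> (\<forall>\<mu>. eigenvalue M \<mu> \<longrightarrow> Re \<mu> < 0)"

definition stabilizable :: "real mat \<Rightarrow> real mat \<Rightarrow> bool" where
  "stabilizable A B \<longleftrightarrow>
     (\<exists>F \<in> carrier_mat (dim_col B) (dim_row A). hurwitz (cmat (A - B * F)))"


text \<open>
  The weight \<^term>\<open>a i k\<close> is positive iff \<^term>\<open>(k, i)\<close> is an edge.
\<close>

definition weight_digraph :: "nat \<Rightarrow> (nat \<Rightarrow> nat \<Rightarrow> real) \<Rightarrow> (nat, nat \<times> nat) pre_digraph" where
  "weight_digraph N a =
     with_proj \<lparr> pverts = {..<N}, parcs = {(k, i). k < N \<and> i < N \<and> a i k > 0} \<rparr>"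

text \<open>
  A directed spanning tree (arborescence): a spanning subgraph with a root from which every vertex
  is reached by exactly one directed walk.
\<close>

definition has_directed_spanning_tree :: "('a, 'b) pre_digraph \<Rightarrow> bool" where
  "has_directed_spanning_tree G \<longleftrightarrow>
     (\<exists>T. spanning T G \<and> (\<exists>r \<in> verts T. \<forall>v \<in> verts T. \<exists>!p. pre_digraph.awalk T r p v))"

definition laplacian :: "nat \<Rightarrow> (nat \<Rightarrow> nat \<Rightarrow> real) \<Rightarrow> real mat" where
  "laplacian N a = Matrix.mat N N
     (\<lambda>(i, k). if i = k then (\<Sum>j \<in> {..<N} - {i}. a i j) else - a i k)"


definition closed_loop :: "nat \<Rightarrow> (nat \<Rightarrow> nat \<Rightarrow> real) \<Rightarrow> real mat \<Rightarrow> real mat \<Rightarrow> real mat \<Rightarrow> real \<Rightarrow> real mat"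
  where "closed_loop N a A B K c = kron (1\<^sub>m N) A - c \<cdot>\<^sub>m kron (laplacian N a) (B * K)"

definition lti_solution :: "real mat \<Rightarrow> (real \<Rightarrow> real Matrix.vec) \<Rightarrow> bool" where
  "lti_solution M x \<longleftrightarrow>
     (\<forall>t\<ge>0. x t \<in> carrier_vec (dim_row M) \<and>
        (\<forall>i<dim_row M.
           ((\<lambda>\<tau>. x \<tau> $ i) has_real_derivative (M *\<^sub>v x t) $ i) (at t within {0..})))"

text \<open>
  Stability in the sense relevant to consensus, for a global state made of \<^term>\<open>N\<close> blocks of
  length \<^term>\<open>n\<close>: along every trajectory all blocks approach each other. The motion common to all
  blocks, i.e. the mode of the Laplacian eigenvalue 0, is unconstrained.
\<close>

definition consensus_stable :: "nat \<Rightarrow> nat \<Rightarrow> real mat \<Rightarrow> bool" where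
  "consensus_stable N n M \<longleftrightarrow>
     (\<forall>x. lti_solution M x \<longrightarrow>
        (\<forall>i<N. \<forall>k<N. \<forall>j<n. ((\<lambda>t. x t $ (i * n + j) - x t $ (k * n + j)) \<longlongrightarrow> 0) at_top))"


definition agent_tf :: "real mat \<Rightarrow> real mat \<Rightarrow> real mat \<Rightarrow> complex \<Rightarrow> complex mat" where
  "agent_tf A B K s = mat_inv (s \<cdot>\<^sub>m 1\<^sub>m (dim_row A) - cmat A) * cmat (B * K)"

definition loop_tf ::
  "nat \<Rightarrow> (nat \<Rightarrow> nat \<Rightarrow> real) \<Rightarrow> real mat \<Rightarrow> real mat \<Rightarrow> real mat \<Rightarrow> real \<Rightarrow> complex \<Rightarrow> complex mat" where
  "loop_tf N a A B K c s =
     kron (1\<^sub>m N) (agent_tf A B K s) *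
     (complex_of_real c \<cdot>\<^sub>m kron (cmat (laplacian N a)) (1\<^sub>m (dim_row A)))"


text \<open>
  Poles of a rational transfer matrix are counted as usual for multivariable systems, i.e. with their
  McMillan multiplicity: the pole polynomial is the least common denominator of all minors of all
  orders, so the multiplicity of \<^term>\<open>z\<close> is the largest order that \<^term>\<open>z\<close> has as a pole of a minor.
\<close>

definition pole_order :: "(complex \<Rightarrow> complex) \<Rightarrow> complex \<Rightarrow> nat" where
  "pole_order f z = (if is_pole f z then nat (- zorder f z) else 0)"

definition pole_mult :: "nat \<Rightarrow> nat \<Rightarrow> (complex \<Rightarrow> complex mat) \<Rightarrow> complex \<Rightarrow> nat" where
  "pole_mult p q G z = Max {pole_order (\<lambda>s. Determinant.det (submatrix (G s) I J)) z | I J.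
     I \<subseteq> {..<p} \<and> J \<subseteq> {..<q} \<and> card I = card J}"

definition tf_poles :: "nat \<Rightarrow> nat \<Rightarrow> (complex \<Rightarrow> complex mat) \<Rightarrow> complex set" where
  "tf_poles p q G = {z. pole_mult p q G z > 0}"

definition num_unstable_poles :: "nat \<Rightarrow> nat \<Rightarrow> (complex \<Rightarrow> complex mat) \<Rightarrow> nat" where
  "num_unstable_poles p q G = (\<Sum>z \<in> {z \<in> tf_poles p q G. Re z \<ge> 0}. pole_mult p q G z)"

text \<open>
  The Nyquist contour with radius \<^term>\<open>R\<close>: up the imaginary axis from \<open>-\<i>R\<close> to \<open>\<i>R\<close>, then back along
  the semicircle in the right half-plane (clockwise). Around each point of \<^term>\<open>P\<close> (the poles on the
  imaginary axis) it makes a semicircular indentation of radius \<^term>\<open>\<epsilon>\<close> into the left half-plane, so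
  that these poles are enclosed; accordingly \<open>num_unstable_poles\<close> includes them. For small
  \<^term>\<open>\<epsilon>\<close> at most one summand below is non-zero at a time.

  Indenting to the right and counting only poles with positive real part would miss an imaginary
  closed-loop eigenvalue that cancels against an open-loop pole in the determinant. The two
  conventions agree when there are no poles on the imaginary axis.
\<close>

definition nyquist_contour :: "complex set \<Rightarrow> real \<Rightarrow> real \<Rightarrow> real \<Rightarrow> complex" where
  "nyquist_contour P \<epsilon> R =
     (\<lambda>t. let z = linepath (- (\<i> * complex_of_real R)) (\<i> * complex_of_real R) t
          in z - complex_of_real (\<Sum>w\<in>P. sqrt (max 0 (\<epsilon>\<^sup>2 - (dist z w)\<^sup>2))))
     +++ part_circlepath 0 R (pi / 2) (- (pi / 2))"

text \<open>
  The Nyquist plot of \<^term>\<open>f\<close> makes \<^term>\<open>k\<close> anti-clockwise encirclements of the origin, for all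
  sufficiently large \<^term>\<open>R\<close> and sufficiently small \<^term>\<open>\<epsilon>\<close>. The number of encirclements
  is defined only if the plot does not pass through the origin.
\<close>

definition nyquist_encircles :: "complex set \<Rightarrow> (complex \<Rightarrow> complex) \<Rightarrow> nat \<Rightarrow> bool" where
  "nyquist_encircles P f k \<longleftrightarrow>
     (\<forall>\<^sub>F (\<epsilon>, R) in at_right 0 \<times>\<^sub>F at_top.
        0 \<notin> path_image (f \<circ> nyquist_contour P \<epsilon> R) \<and>
        winding_number (f \<circ> nyquist_contour P \<epsilon> R) 0 = of_nat k)"

end

theory Submission
  imports Defs "Jordan_Normal_Form.Schur_Decomposition"
begin

text \<open>
  Consensus is a statement about the differences of the agents. Taking the differences with agent 0
  divides the Laplacian \<open>L\<close> by the constant vectors and leaves a matrix \<open>L'\<close> with the eigenvalues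
  \<open>\<lambda>\<^sub>2, \<dots>, \<lambda>\<^sub>N\<close> (\<open>char_poly_reduced_laplacian\<close>); the differences then obey the linear system with matrix
  \<open>I \<otimes> A - c L' \<otimes> BK\<close>. Every trajectory of that system comes from a trajectory of the network, so
  consensus holds iff this matrix is Hurwitz (\<open>consensus_iff_reduced_hurwitz\<close>). Triangularising \<open>L'\<close>
  factors \<open>det (I \<otimes> P + L' \<otimes> Q)\<close> as \<open>\<Prod>\<^sub>p det (P + \<lambda>\<^sub>p Q)\<close> (\<open>det_kron_pencil\<close>). This turns the Hurwitz
  condition into the one on the \<open>N - 1\<close> modes \<open>A - c \<lambda>\<^sub>p BK\<close>, and it shows that the two Nyquist functions
  in the theorem are the same function
  \<open>f (s) = \<Prod>\<^sub>p det (s I - A + c \<lambda>\<^sub>p BK) / \<chi>\<^sub>A (s) ^ (N - 1)\<close>, whose numerator is the characteristic polynomial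
  of the difference system.

  It remains to count. The Nyquist contour is only continuous (the indentations have vertical
  tangents), so the argument principle is replaced by additivity of winding numbers: \<open>f\<close> along the
  contour winds around 0 as often as the contour winds around the zeros of \<open>f\<close> minus around its poles,
  and the contour winds \<open>-1\<close> times around points of the closed right half-plane and 0 times around
  the others (\<open>nyquist_criterion\<close>). Hence the plot winds as often as \<open>\<chi>\<^sub>A ^ (N - 1)\<close> has zeros in the closed
  right half-plane iff the numerator has none there.

  Finally, these zeros of \<open>\<chi>\<^sub>A ^ (N - 1)\<close> are the unstable poles of the loop with their McMillan
  multiplicity (\<open>pole_mult_loop\<close>). They bound the pole orders because \<open>L\<close> factors through dimension
  \<open>N - 1\<close>, so that every minor of the loop is a polynomial over \<open>\<chi>\<^sub>A ^ (N - 1)\<close>, by a bordered determinant. The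
  bound is attained: \<open>det (I + t HL (s))\<close> is a combination of principal minors, and for a
  suitable gain \<open>t\<close> its numerator does not vanish at the given point. Such a gain exists because
  \<open>s I - A + BK\<close> is regular for \<open>Re s \<ge> 0\<close> and because \<open>\<lambda>\<^sub>2, \<dots>, \<lambda>\<^sub>N\<close> are nonzero, which is where
  strong connectivity enters, by a maximum principle.
\<close>

no_notation fps_nth (infixl \<open>$\<close> 75)

section \<open>Kronecker products and block determinants\<close>

lemma kron_carrier [simp]:
  "P \<in> carrier_mat r s \<Longrightarrow> Q \<in> carrier_mat p q \<Longrightarrow> kron P Q \<in> carrier_mat (r * p) (s * q)"
  by (auto simp: kron_def)

lemma kron_dim [simp]:
  "dim_row (kron P Q) = dim_row P * dim_row Q" "dim_col (kron P Q) = dim_col P * dim_col Q"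
  by (simp_all add: kron_def)

lemma kron_index:
  assumes "P \<in> carrier_mat r s" "Q \<in> carrier_mat p q" "i < r * p" "j < s * q"
  shows "kron P Q $$ (i, j) = P $$ (i div p, j div q) * Q $$ (i mod p, j mod q)"
  using assms by (auto simp: kron_def)

lemma sum_div_mod:
  fixes f :: "nat \<Rightarrow> nat \<Rightarrow> 'a :: comm_monoid_add"
  shows "(\<Sum>k<s * q. f (k div q) (k mod q)) = (\<Sum>i<s. \<Sum>j<q. f i j)"
proof -
  have "(\<Sum>k<s * q. f (k div q) (k mod q)) = (\<Sum>i<s. \<Sum>k\<in>{i * q..<i * q + q}. f (k div q) (k mod q))"
    by (rule sum.nat_group[symmetric])
  also have "\<dots> = (\<Sum>i<s. \<Sum>j<q. f i j)"
  proof (rule sum.cong[OF refl])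
    fix i
    have "(i * q + j) div q = i \<and> (i * q + j) mod q = j" if "j < q" for j
      using that by auto
    then show "(\<Sum>k\<in>{i * q..<i * q + q}. f (k div q) (k mod q)) = (\<Sum>j<q. f i j)"
      by (intro sum.reindex_bij_witness[of _ "\<lambda>j. i * q + j" "\<lambda>k. k - i * q"])
         (auto simp: le_iff_add)
  qed
  finally show ?thesis .
qed

lemma div_mod_less:
  fixes i :: nat
  assumes "i < r * p" shows "i div p < r" "i mod p < p"
proof -
  have "p > 0" using assms by (cases p) auto
  then show "i div p < r" "i mod p < p" using assms by (auto simp: less_mult_imp_div_less)
qed

lemma kron_mult:
  fixes P Q R S :: "'a :: comm_semiring_0 mat"
  assumes P: "P \<in> carrier_mat r s" and Q: "Q \<in> carrier_mat p q"
    and R: "R \<in> carrier_mat s t" and S: "S \<in> carrier_mat q u"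
  shows "kron P Q * kron R S = kron (P * R) (Q * S)"
proof (rule eq_matI)
  fix i j assume "i < dim_row (kron (P * R) (Q * S))" "j < dim_col (kron (P * R) (Q * S))"
  then have i: "i < r * p" and j: "j < t * u" using assms by auto
  note d = div_mod_less[OF i] div_mod_less[OF j]
  have "(kron P Q * kron R S) $$ (i, j) = (\<Sum>k<s * q. kron P Q $$ (i, k) * kron R S $$ (k, j))"
    using assms i j by (auto simp: scalar_prod_def lessThan_atLeast0)
  also have "\<dots> = (\<Sum>k<s * q. P $$ (i div p, k div q) * Q $$ (i mod p, k mod q) *
      (R $$ (k div q, j div u) * S $$ (k mod q, j mod u)))"
    using i j by (intro sum.cong) (auto simp: kron_index[OF P Q] kron_index[OF R S])
  also have "\<dots> = (\<Sum>k<s. \<Sum>l<q. P $$ (i div p, k) * Q $$ (i mod p, l) * (R $$ (k, j div u) * S $$ (l, j mod u)))"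
    by (rule sum_div_mod)
  also have "\<dots> = (\<Sum>k<s. P $$ (i div p, k) * R $$ (k, j div u)) * (\<Sum>l<q. Q $$ (i mod p, l) * S $$ (l, j mod u))"
    by (simp add: sum_product mult_ac)
  also have "\<dots> = (P * R) $$ (i div p, j div u) * (Q * S) $$ (i mod p, j mod u)"
    using assms d by (simp add: scalar_prod_def lessThan_atLeast0)
  also have "\<dots> = kron (P * R) (Q * S) $$ (i, j)"
    using assms i j by (subst kron_index[of _ r t _ p u]) auto
  finally show "(kron P Q * kron R S) $$ (i, j) = kron (P * R) (Q * S) $$ (i, j)" .
qed (use assms in auto)

lemma kron_one: "kron (1\<^sub>m r) (1\<^sub>m p) = (1\<^sub>m (r * p) :: 'a :: comm_semiring_1 mat)"
proof (rule eq_matI)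
  fix i j assume "i < dim_row (1\<^sub>m (r * p) :: 'a mat)" "j < dim_col (1\<^sub>m (r * p) :: 'a mat)"
  then have i: "i < r * p" and j: "j < r * p" by auto
  have "i div p = j div p \<and> i mod p = j mod p \<longleftrightarrow> i = j" by (metis div_mult_mod_eq)
  then show "kron (1\<^sub>m r) (1\<^sub>m p) $$ (i, j) = (1\<^sub>m (r * p) :: 'a mat) $$ (i, j)"
    using i j div_mod_less[OF i] div_mod_less[OF j]
    by (subst kron_index[of _ r r _ p p]) auto
qed auto

lemma kron_smult_right:
  "kron P (k \<cdot>\<^sub>m Q) = k \<cdot>\<^sub>m kron P (Q :: 'a :: comm_semiring_0 mat)"
  by (intro eq_matI) (auto simp: kron_def div_mod_less mult_ac)

text \<open>
  With \<open>U\<close> upper triangular the Kronecker matrix is block upper triangular; the induction splits off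
  the first block row and column.
\<close>

lemma det_kron_pencil_upper_triangular:
  fixes U P Q :: "'a :: idom mat"
  assumes "U \<in> carrier_mat r r" "upper_triangular U" "P \<in> carrier_mat p p" "Q \<in> carrier_mat p p"
  shows "Determinant.det (kron (1\<^sub>m r) P + kron U Q) = (\<Prod>\<mu>\<leftarrow>diag_mat U. Determinant.det (P + \<mu> \<cdot>\<^sub>m Q))"
  using assms(1,2)
proof (induction r arbitrary: U)
  case 0
  then have "kron (1\<^sub>m 0) P + kron U Q \<in> carrier_mat 0 0" by auto
  with 0 show ?case by (simp add: diag_mat_def)
next
  case (Suc r)
  define U' where "U' = Matrix.mat r r (\<lambda>(i, j). U $$ (Suc i, Suc j))"
  define T where "T = Matrix.mat p (r * p) (\<lambda>(i, j). U $$ (0, Suc (j div p)) * Q $$ (i, j mod p))"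
  have U': "U' \<in> carrier_mat r r" "upper_triangular U'"
    using Suc.prems by (auto simp: U'_def upper_triangular_def)
  have diag: "diag_mat U = U $$ (0,0) # diag_mat U'"
    using Suc.prems by (auto simp: diag_mat_def U'_def upt_conv_Cons map_Suc_upt[symmetric] simp del: upt_Suc map_Suc_upt)
  have "kron (1\<^sub>m (Suc r)) P + kron U Q =
    four_block_mat (P + U $$ (0,0) \<cdot>\<^sub>m Q) T (0\<^sub>m (r * p) p) (kron (1\<^sub>m r) P + kron U' Q)"
    (is "?L = ?R")
  proof (rule eq_matI)
    show "dim_row ?L = dim_row ?R" "dim_col ?L = dim_col ?R" using Suc.prems assms U' by auto
    fix i j assume "i < dim_row ?R" "j < dim_col ?R"
    then have i: "i < Suc r * p" and j: "j < Suc r * p" using Suc.prems assms U' by auto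
    have idm: "i = (i - p) + p \<and> i - p < r * p" if "\<not> i < p" using that i by auto
    have jdm: "j = (j - p) + p \<and> j - p < r * p" if "\<not> j < p" using that j by auto
    have idiv: "i div p = Suc ((i - p) div p) \<and> i mod p = (i - p) mod p" if "\<not> i < p"
      using that i by (cases "p = 0") (auto simp: le_div_geq le_mod_geq)
    have jdiv: "j div p = Suc ((j - p) div p) \<and> j mod p = (j - p) mod p" if "\<not> j < p"
      using that j by (cases "p = 0") (auto simp: le_div_geq le_mod_geq)
    have low: "U $$ (Suc k, 0) = 0" if "k < r" for k
      using Suc.prems that by (auto simp: upper_triangular_def)
    show "?L $$ (i, j) = ?R $$ (i, j)"
      using i j Suc.prems(1) assms U'(1) div_mod_less[of "i - p" r p] div_mod_less[of "j - p" r p] idm jdm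
      by (cases "i < p"; cases "j < p") (auto simp: kron_def T_def idiv jdiv low U'_def)
  qed
  then have "Determinant.det (kron (1\<^sub>m (Suc r)) P + kron U Q) =
      Determinant.det (P + U $$ (0,0) \<cdot>\<^sub>m Q) * Determinant.det (kron (1\<^sub>m r) P + kron U' Q)"
    using assms U'(1)
    by (simp add: det_four_block_mat_lower_left_zero[of _ p _ "r * p"] T_def)
  then show ?case using Suc.IH[OF U'] diag by simp
qed

text \<open>
  A Schur triangularisation \<open>X = S U S\<^sup>-\<^sup>1\<close> acts on the first Kronecker factor alone, so \<open>S \<otimes> I\<close> makes
  the pencil block triangular without touching \<open>P\<close> and \<open>Q\<close>. This is the modal decomposition of the network.
\<close>

lemma det_kron_pencil:
  fixes X P Q :: "complex mat"
  assumes X: "X \<in> carrier_mat r r" and cp: "char_poly X = (\<Prod>\<mu>\<leftarrow>ms. [:- \<mu>, 1:])"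
    and P: "P \<in> carrier_mat p p" and Q: "Q \<in> carrier_mat p p"
  shows "Determinant.det (kron (1\<^sub>m r) P + kron X Q) = (\<Prod>\<mu>\<leftarrow>ms. Determinant.det (P + \<mu> \<cdot>\<^sub>m Q))"
proof -
  obtain U S T where "schur_decomposition X ms = (U, S, T)" by (cases "schur_decomposition X ms") auto
  from schur_decomposition[OF X cp this]
  have sim: "similar_mat_wit X U S T" and ut: "upper_triangular U" and dg: "diag_mat U = ms" by auto
  note w = similar_mat_witD2[OF X sim]
  have "kron (1\<^sub>m r) P + kron X Q = kron S (1\<^sub>m p) * (kron (1\<^sub>m r) P + kron U Q) * kron T (1\<^sub>m p)"
  proof -
    have "kron S (1\<^sub>m p) * (kron (1\<^sub>m r) P + kron U Q) * kron T (1\<^sub>m p)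
      = (kron S (1\<^sub>m p) * kron (1\<^sub>m r) P + kron S (1\<^sub>m p) * kron U Q) * kron T (1\<^sub>m p)"
      using w P Q by (subst mult_add_distrib_mat[of _ "r * p" "r * p" _ "r * p"]) auto
    also have "\<dots> = (kron S P + kron (S * U) Q) * kron T (1\<^sub>m p)"
      using w P Q by (simp add: kron_mult[of _ r r _ p p _ r _ p])
    also have "\<dots> = kron S P * kron T (1\<^sub>m p) + kron (S * U) Q * kron T (1\<^sub>m p)"
      using w P Q by (subst add_mult_distrib_mat[of _ "r * p" "r * p" _ _ "r * p"]) auto
    also have "\<dots> = kron (S * T) P + kron (S * U * T) Q"
      using w P Q by (simp add: kron_mult[of _ r r _ p p _ r _ p])
    finally show ?thesis using w by simp
  qed
  moreover have "Determinant.det (kron S (1\<^sub>m p)) * Determinant.det (kron T (1\<^sub>m p)) = 1"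
    using w by (simp add: det_mult[of _ "r * p", symmetric] kron_mult[of _ r r _ p p _ r _ p] kron_one)
  moreover have "Determinant.det (kron S (1\<^sub>m p) * (kron (1\<^sub>m r) P + kron U Q) * kron T (1\<^sub>m p)) =
    Determinant.det (kron S (1\<^sub>m p)) * Determinant.det (kron (1\<^sub>m r) P + kron U Q) * Determinant.det (kron T (1\<^sub>m p))"
  proof -
    have c: "kron S (1\<^sub>m p) \<in> carrier_mat (r * p) (r * p)" "kron T (1\<^sub>m p) \<in> carrier_mat (r * p) (r * p)"
      "kron (1\<^sub>m r) P + kron U Q \<in> carrier_mat (r * p) (r * p)"
      using w P Q by auto
    show ?thesis using c by (simp only: det_mult[OF mult_carrier_mat[OF c(1) c(3)] c(2)] det_mult[OF c(1) c(3)])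
  qed
  ultimately have "Determinant.det (kron (1\<^sub>m r) P + kron X Q) = Determinant.det (kron (1\<^sub>m r) P + kron U Q)"
    by (metis mult.commute mult.left_commute mult.right_neutral)
  then show ?thesis using det_kron_pencil_upper_triangular[OF w(5) ut P Q] dg by simp
qed

section \<open>Minors and poles of rational matrices\<close>

lemma poly_char_poly:
  fixes A :: "'a :: field mat"
  assumes "A \<in> carrier_mat n n"
  shows "poly (char_poly A) s = Determinant.det (s \<cdot>\<^sub>m 1\<^sub>m n - A)"
proof -
  have "- char_matrix A s = s \<cdot>\<^sub>m 1\<^sub>m n - A"
    using assms by (intro eq_matI) (auto simp: char_matrix_def)
  then show ?thesis using char_poly_matrix[OF assms] by simp
qed

lemma det_affine_polynomial:
  fixes E F :: "'a :: field mat"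
  assumes "E \<in> carrier_mat k k" "F \<in> carrier_mat k k"
  obtains u where "\<And>s. poly u s = Determinant.det (s \<cdot>\<^sub>m E + F)"
proof -
  have "poly (Determinant.det (Matrix.mat k k (\<lambda>(i, j). [:F $$ (i, j), E $$ (i, j):]))) s
      = Determinant.det (s \<cdot>\<^sub>m E + F)" for s
    using assms by (intro poly_det_cong[of _ k]) auto
  then show ?thesis using that by blast
qed

lemma mat_inv_inverse:
  fixes M :: "'a :: field mat"
  assumes M: "M \<in> carrier_mat n n" and d: "Determinant.det M \<noteq> 0"
  shows "mat_inv M \<in> carrier_mat n n" "M * mat_inv M = 1\<^sub>m n" "mat_inv M * M = 1\<^sub>m n"
proof -
  have "mat_inverse M \<noteq> None"
    using mat_inverse(1)[OF M, of n] det_non_zero_imp_unit[OF M d, of n] by auto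
  then obtain X where X: "mat_inverse M = Some X" by auto
  then show "mat_inv M \<in> carrier_mat n n" "M * mat_inv M = 1\<^sub>m n" "mat_inv M * M = 1\<^sub>m n"
    using mat_inverse(2)[OF M X] by (auto simp: mat_inv_def)
qed

lemma mat_inv_carrier:
  fixes M :: "'a :: field mat"
  assumes M: "M \<in> carrier_mat n n"
  shows "mat_inv M \<in> carrier_mat n n"
  using assms mat_inverse(2)[OF M] by (auto simp: mat_inv_def split: option.splits)

text \<open>
  A Schur complement: the numerator of a minor of \<open>R M\<^sup>-\<^sup>1 S\<close> over the denominator \<open>det M\<close> is itself a
  determinant, hence polynomial in the entries. All pole orders of the loop are bounded by this.
\<close>

lemma det_bordered:
  fixes M Mi R S :: "'a :: field mat"
  assumes M: "M \<in> carrier_mat l l" and Mi: "Mi \<in> carrier_mat l l" "M * Mi = 1\<^sub>m l"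
    and R: "R \<in> carrier_mat k l" and S: "S \<in> carrier_mat l k"
  shows "Determinant.det (four_block_mat M S (- R) (0\<^sub>m k k)) =
    Determinant.det M * Determinant.det (R * Mi * S)"
proof -
  \<comment> \<open>block elimination: the left factor carries \<open>det M\<close>, the right one the Schur complement\<close>
  have "four_block_mat M (0\<^sub>m l k) (- R) (1\<^sub>m k) * four_block_mat (1\<^sub>m l) (Mi * S) (0\<^sub>m k l) (R * Mi * S)
    = four_block_mat (M * 1\<^sub>m l + 0\<^sub>m l k * 0\<^sub>m k l) (M * (Mi * S) + 0\<^sub>m l k * (R * Mi * S))
       (- R * 1\<^sub>m l + 1\<^sub>m k * 0\<^sub>m k l) (- R * (Mi * S) + 1\<^sub>m k * (R * Mi * S))"
    using assms by (intro mult_four_block_mat) auto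
  also have "M * (Mi * S) = S"
    using assms by (simp add: assoc_mult_mat[of M l l Mi l S k, symmetric])
  also have "- R * (Mi * S) + 1\<^sub>m k * (R * Mi * S) = 0\<^sub>m k k"
  proof -
    have "R * (Mi * S) = R * Mi * S"
      using assms by (simp add: assoc_mult_mat[of R k l Mi l S k])
    moreover have "- R * (Mi * S) = - (R * (Mi * S))"
      using assms by (intro uminus_mult_left_mat) auto
    ultimately show ?thesis using assms by (intro eq_matI) auto
  qed
  finally have "four_block_mat M S (- R) (0\<^sub>m k k) =
    four_block_mat M (0\<^sub>m l k) (- R) (1\<^sub>m k) * four_block_mat (1\<^sub>m l) (Mi * S) (0\<^sub>m k l) (R * Mi * S)"
    using assms by simp
  then have "Determinant.det (four_block_mat M S (- R) (0\<^sub>m k k)) =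
    Determinant.det (four_block_mat M (0\<^sub>m l k) (- R) (1\<^sub>m k)) *
    Determinant.det (four_block_mat (1\<^sub>m l) (Mi * S) (0\<^sub>m k l) (R * Mi * S))"
    using assms by (simp add: det_mult[of _ "l + k"])
  also have "Determinant.det (four_block_mat M (0\<^sub>m l k) (- R) (1\<^sub>m k)) = Determinant.det M"
    using assms by (subst det_four_block_mat_upper_right_zero[of _ l _ k]) auto
  also have "Determinant.det (four_block_mat (1\<^sub>m l) (Mi * S) (0\<^sub>m k l) (R * Mi * S)) = Determinant.det (R * Mi * S)"
    using assms by (subst det_four_block_mat_lower_left_zero[of _ l _ k]) auto
  finally show ?thesis .
qed

text \<open>
  The Leibniz formula of a principal submatrix, transported from the initial segment of indices to
  \<open>I\<close>, so that minors for different \<open>I\<close> can be compared inside one sum over permutations.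
\<close>

lemma det_submatrix_principal:
  fixes G :: "'a :: comm_ring_1 mat"
  assumes G: "G \<in> carrier_mat n n" and I: "I \<subseteq> {0..<n}"
  shows "Determinant.det (submatrix G I I) = (\<Sum>p | p permutes I. signof p * (\<Prod>i\<in>I. G $$ (i, p i)))"
proof -
  let ?k = "card I"
  have fin: "finite I" using I finite_subset by auto
  have ci: "{i. i < n \<and> i \<in> I} = I" using I by auto
  have bij: "bij_betw (pick I) {0..<?k} I"
  proof (rule bij_betw_imageI)
    show "inj_on (pick I) {0..<?k}"
      using pick_mono_le[of _ I] by (intro linorder_inj_onI) (force simp: not_less)+
    have sub: "pick I ` {0..<?k} \<subseteq> I" using pick_in_set_le[of _ I] by auto
    show "pick I ` {0..<?k} = I"
      using \<open>inj_on (pick I) {0..<?k}\<close> by (intro card_subset_eq[OF fin sub]) (simp add: card_image)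
  qed
  have dims: "submatrix G I I \<in> carrier_mat ?k ?k"
    using G ci by (auto simp: submatrix_def)
  have ent: "submatrix G I I $$ (i, j) = G $$ (pick I i, pick I j)" if "i < ?k" "j < ?k" for i j
    using G ci that by (subst submatrix_index) auto
  let ?\<phi> = "\<lambda>p x. if x \<in> I then pick I (p (inv_into {0..<?k} (pick I) x)) else x"
  have "Determinant.det (submatrix G I I) =
      (\<Sum>p | p permutes {0..<?k}. signof p * (\<Prod>i = 0..<?k. submatrix G I I $$ (i, p i)))"
    by (rule det_def'[OF dims])
  also have "\<dots> = (\<Sum>p | p permutes {0..<?k}. signof (?\<phi> p) * (\<Prod>i\<in>I. G $$ (i, ?\<phi> p i)))"
  proof (rule sum.cong[OF refl], goal_cases)
    case (1 p)
    then have p: "p permutes {0..<?k}" by simp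
    interpret permutes_bij_finite p "{0..<?k}" I "pick I" "inv_into {0..<?k} (pick I)" "?\<phi> p"
      by unfold_locales (use p bij in \<open>auto simp: bij_betw_inv_into_left\<close>)
    have "(\<Prod>i\<in>I. G $$ (i, ?\<phi> p i)) = (\<Prod>i = 0..<?k. G $$ (pick I i, ?\<phi> p (pick I i)))"
      by (rule prod.reindex_bij_betw[OF bij, symmetric])
    also have "\<dots> = (\<Prod>i = 0..<?k. submatrix G I I $$ (i, p i))"
    proof (rule prod.cong[OF refl])
      fix i assume i: "i \<in> {0..<?k}"
      have "p i < ?k" using permutes_in_image[OF p, of i] i by auto
      moreover have "pick I i \<in> I" using bij i by (auto simp: bij_betw_def)
      ultimately show "G $$ (pick I i, ?\<phi> p (pick I i)) = submatrix G I I $$ (i, p i)"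
        using i bij ent by (simp add: bij_betw_inv_into_left)
    qed
    finally show ?case using sign_p' by simp
  qed
  also have "\<dots> = (\<Sum>p | p permutes I. signof p * (\<Prod>i\<in>I. G $$ (i, p i)))"
    by (rule sum.reindex_bij_betw[OF bij_betw_permutations[OF bij]])
  finally show ?thesis .
qed

text \<open>
  In the Leibniz formula of \<open>det (1 + t G)\<close> the factors are multiplied out; choosing the identity
  outside \<open>I\<close> forces the permutation to fix every index outside \<open>I\<close>.
\<close>

lemma det_one_plus_principal_minors:
  fixes G :: "'a :: comm_ring_1 mat"
  assumes G: "G \<in> carrier_mat n n"
  shows "Determinant.det (1\<^sub>m n + t \<cdot>\<^sub>m G) =
    (\<Sum>I\<in>Pow {0..<n}. t ^ card I * Determinant.det (submatrix G I I))"
proof -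
  let ?N = "{0..<n}"
  have "Determinant.det (1\<^sub>m n + t \<cdot>\<^sub>m G) =
    (\<Sum>p | p permutes ?N. signof p * (\<Prod>i\<in>?N. (1\<^sub>m n + t \<cdot>\<^sub>m G) $$ (i, p i)))"
    using G by (intro det_def') auto
  also have "\<dots> = (\<Sum>p | p permutes ?N. signof p * (\<Prod>i\<in>?N. t * G $$ (i, p i) + of_bool (p i = i)))"
  proof (intro sum.cong refl arg_cong2[of _ _ _ _ "(*)"] prod.cong, goal_cases)
    case (1 p i)
    then have "p i < n" using permutes_in_image[of p ?N i] by auto
    then show ?case using 1 G by auto
  qed
  also have "\<dots> = (\<Sum>p | p permutes ?N. signof p * (\<Sum>I\<in>Pow ?N. t ^ card I * (\<Prod>i\<in>I. G $$ (i, p i)) * of_bool (p permutes I)))"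
  proof (intro sum.cong refl arg_cong2[of _ _ _ _ "(*)"], goal_cases)
    case (1 p)
    then have p: "p permutes ?N" by simp
    have "(\<Prod>i\<in>?N. t * G $$ (i, p i) + of_bool (p i = i)) =
      (\<Sum>I\<in>Pow ?N. (\<Prod>i\<in>I. t * G $$ (i, p i)) * (\<Prod>i\<in>?N - I. of_bool (p i = i)))"
      by (rule prod_add) simp
    also have "\<dots> = (\<Sum>I\<in>Pow ?N. t ^ card I * (\<Prod>i\<in>I. G $$ (i, p i)) * of_bool (p permutes I))"
    proof (rule sum.cong[OF refl])
      fix I assume I: "I \<in> Pow ?N"
      have "p permutes I \<longleftrightarrow> (\<forall>i\<in>?N - I. p i = i)"
      proof
        assume "p permutes I" then show "\<forall>i\<in>?N - I. p i = i" by (auto simp: permutes_not_in)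
      next
        assume "\<forall>i\<in>?N - I. p i = i"
        then show "p permutes I" using permutes_superset[OF p, of I] by auto
      qed
      then have "(\<Prod>i\<in>?N - I. of_bool (p i = i)) = (of_bool (p permutes I) :: 'a)"
      proof (cases "\<forall>i\<in>?N - I. p i = i")
        case False
        then have "(\<Prod>i\<in>?N - I. of_bool (p i = i)) = (0 :: 'a)" by (intro prod_zero) auto
        then show ?thesis using False \<open>p permutes I \<longleftrightarrow> (\<forall>i\<in>?N - I. p i = i)\<close> by simp
      qed simp
      then show "(\<Prod>i\<in>I. t * G $$ (i, p i)) * (\<Prod>i\<in>?N - I. of_bool (p i = i)) =
        t ^ card I * (\<Prod>i\<in>I. G $$ (i, p i)) * of_bool (p permutes I)"
        by (simp add: prod.distrib)
    qed
    finally show ?case .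
  qed
  also have "\<dots> = (\<Sum>I\<in>Pow ?N. \<Sum>p | p permutes ?N. of_bool (p permutes I) * (t ^ card I * (signof p * (\<Prod>i\<in>I. G $$ (i, p i)))))"
    by (subst sum.swap) (simp add: sum_distrib_left mult_ac)
  also have "\<dots> = (\<Sum>I\<in>Pow ?N. t ^ card I * Determinant.det (submatrix G I I))"
  proof (rule sum.cong[OF refl])
    fix I assume I: "I \<in> Pow ?N"
    have "(\<Sum>p | p permutes ?N. of_bool (p permutes I) * (t ^ card I * (signof p * (\<Prod>i\<in>I. G $$ (i, p i)))))
      = (\<Sum>p | p permutes I. t ^ card I * (signof p * (\<Prod>i\<in>I. G $$ (i, p i))))"
      using I by (intro sum.mono_neutral_cong_right) (auto intro: permutes_subset finite_permutations)
    then show "(\<Sum>p | p permutes ?N. of_bool (p permutes I) * (t ^ card I * (signof p * (\<Prod>i\<in>I. G $$ (i, p i)))))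
      = t ^ card I * Determinant.det (submatrix G I I)"
      using det_submatrix_principal[OF G, of I] I by (simp add: sum_distrib_left)
  qed
  finally show ?thesis .
qed

text \<open>
  The order of the denominator bounds the pole order, and a strictly smaller pole order can only come
  from a cancellation. The hypothesis ignores the zeros of \<open>r\<close>, where a function totalised at its
  poles takes arbitrary values.
\<close>

lemma pole_order_rational:
  fixes u r :: "complex poly"
  assumes r: "r \<noteq> 0" and f: "\<And>s. poly r s \<noteq> 0 \<Longrightarrow> f s = poly u s / poly r s"
  shows "pole_order f z \<le> Polynomial.order z r"
    and "pole_order f z < Polynomial.order z r \<Longrightarrow> poly u z = 0"
proof -
  have ev: "\<forall>\<^sub>F s in at z. poly p s \<noteq> 0" if "p \<noteq> 0" for p :: "complex poly"
  proof -
    have "finite {s. poly p s = 0}" using that by (rule poly_roots_finite)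
    then have "\<forall>\<^sub>F s in at z. s \<notin> {s. poly p s = 0}"
      using islimpt_finite islimpt_iff_eventually by blast
    then show ?thesis by simp
  qed
  have zp: "zorder (poly p) z = int (Polynomial.order z p)" if "p \<noteq> 0" for p :: "complex poly"
  proof -
    obtain q where q: "p = [:- z, 1:] ^ Polynomial.order z p * q" "\<not> [:- z, 1:] dvd q"
      using order_decomp[OF \<open>p \<noteq> 0\<close>, of z] by blast
    show ?thesis
    proof (rule zorder_eqI)
      show "open (UNIV :: complex set)" "z \<in> UNIV" "poly q holomorphic_on UNIV" by (auto intro: holomorphic_intros)
      show "poly q z \<noteq> 0" using q(2) by (simp add: poly_eq_0_iff_dvd)
      show "poly p w = poly q w * (w - z) powi int (Polynomial.order z p)" if "w \<in> UNIV" "w \<noteq> z" for w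
        by (subst q(1)) (simp add: mult.commute)
    qed
  qed
  have fe: "\<forall>\<^sub>F s in at z. f s = poly u s / poly r s"
    using ev[OF r] f by (auto elim!: eventually_mono)
  have an: "poly p meromorphic_on {z}" for p :: "complex poly"
  proof -
    have "poly p holomorphic_on UNIV" by (auto intro: holomorphic_intros)
    then have "poly p analytic_on UNIV" by (simp add: analytic_on_open)
    then show ?thesis by (intro analytic_on_imp_meromorphic_on) (rule analytic_on_subset, auto)
  qed
  have main: "pole_order f z \<le> Polynomial.order z r \<and> (pole_order f z < Polynomial.order z r \<longrightarrow> poly u z = 0)"
  proof (cases "u = 0")
    case True
    then have "is_pole f z \<longleftrightarrow> is_pole (\<lambda>_. 0 :: complex) z"
      using fe by (intro is_pole_cong) auto
    then show ?thesis using True by (simp add: pole_order_def)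
  next
    case False
    have "zorder f z = zorder (\<lambda>s. poly u s / poly r s) z"
      using fe by (intro zorder_cong) auto
    also have "\<dots> = int (Polynomial.order z u) - int (Polynomial.order z r)"
      using zorder_divide[OF an _ an] ev[OF False] ev[OF r] zp r False
      by (simp add: eventually_frequently)
    finally have zo: "zorder f z = int (Polynomial.order z u) - int (Polynomial.order z r)" .
    have pole: "is_pole f z" if "Polynomial.order z u < Polynomial.order z r"
    proof -
      have "is_pole (\<lambda>s. poly u s / poly r s) z"
      proof (rule zorder_neg_imp_is_pole)
        show "(\<lambda>s. poly u s / poly r s) meromorphic_on {z}" using an by (intro meromorphic_intros)
        show "\<forall>\<^sub>F s in at z. poly u s / poly r s \<noteq> 0"
          using eventually_conj[OF ev[OF False] ev[OF r]] by (auto elim!: eventually_mono)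
        have "zorder f z < 0" using zo that by simp
        then show "zorder (\<lambda>s. poly u s / poly r s) z < 0"
          using zo \<open>zorder f z = zorder (\<lambda>s. poly u s / poly r s) z\<close> by simp
      qed
      then show ?thesis using is_pole_cong[OF fe refl] by simp
    qed
    show ?thesis
      using zo pole False order_root[of u z] by (auto simp: pole_order_def)
  qed
  then show "pole_order f z \<le> Polynomial.order z r" "pole_order f z < Polynomial.order z r \<Longrightarrow> poly u z = 0" by auto
qed

section \<open>Reduction of the Laplacian\<close>

text \<open>
  When the row sums of \<open>L\<close> vanish, this is the matrix of \<open>L\<close> on the quotient by the constant vectors, in
  the coordinates \<open>x\<^sub>i - x\<^sub>0\<close>.
\<close>

definition reduced_laplacian :: "'a :: ring_1 mat \<Rightarrow> 'a mat" where
  "reduced_laplacian L = Matrix.mat (dim_row L - 1) (dim_row L - 1)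
     (\<lambda>(i, j). L $$ (Suc i, Suc j) - L $$ (0, Suc j))"

definition tail_columns :: "'a mat \<Rightarrow> 'a mat" where
  "tail_columns L = Matrix.mat (dim_row L) (dim_row L - 1) (\<lambda>(i, j). L $$ (i, Suc j))"

definition difference_mat :: "nat \<Rightarrow> 'a :: ring_1 mat" where
  "difference_mat r = Matrix.mat r (Suc r) (\<lambda>(i, j). of_bool (j = Suc i) - of_bool (j = 0))"

lemma reduction_carrier [simp]:
  "L \<in> carrier_mat (Suc r) (Suc r) \<Longrightarrow> reduced_laplacian L \<in> carrier_mat r r"
  "L \<in> carrier_mat (Suc r) (Suc r) \<Longrightarrow> tail_columns L \<in> carrier_mat (Suc r) r"
  "difference_mat r \<in> carrier_mat r (Suc r)"
  by (auto simp: reduced_laplacian_def tail_columns_def difference_mat_def)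

lemma difference_mat_mult:
  fixes M :: "'a :: comm_ring_1 mat"
  assumes M: "M \<in> carrier_mat (Suc r) q" and ij: "i < r" "j < q"
  shows "(difference_mat r * M) $$ (i, j) = M $$ (Suc i, j) - M $$ (0, j)"
proof -
  have "(difference_mat r * M) $$ (i, j) =
      (\<Sum>k<Suc r. (of_bool (k = Suc i) - of_bool (k = 0)) * M $$ (k, j))"
    using assms by (auto simp: difference_mat_def scalar_prod_def lessThan_atLeast0)
  also have "\<dots> = (\<Sum>k<Suc r. if k = Suc i then M $$ (k, j) else 0) - (\<Sum>k<Suc r. if k = 0 then M $$ (k, j) else 0)"
    unfolding sum_subtractf[symmetric] by (intro sum.cong) auto
  finally show ?thesis using ij by simp
qed

text \<open>
  Vanishing row sums make the first column redundant. This exhibits \<open>L\<close> as a product through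
  dimension \<open>r\<close>, which limits the McMillan degree of the loop to \<open>r\<close> copies of an agent.
\<close>

lemma tail_columns_difference_mat:
  fixes L :: "'a :: comm_ring_1 mat"
  assumes L: "L \<in> carrier_mat (Suc r) (Suc r)" and rows: "\<And>i. i < Suc r \<Longrightarrow> (\<Sum>k<Suc r. L $$ (i, k)) = 0"
  shows "tail_columns L * difference_mat r = L"
proof (rule eq_matI)
  fix i j assume "i < dim_row L" "j < dim_col L"
  then have i: "i < Suc r" and j: "j < Suc r" using L by auto
  have "(tail_columns L * difference_mat r) $$ (i, j) = (\<Sum>k<r. L $$ (i, Suc k) * (of_bool (j = Suc k) - of_bool (j = 0)))"
    using L i j by (auto simp: difference_mat_def tail_columns_def scalar_prod_def lessThan_atLeast0)
  also have "\<dots> = L $$ (i, j)"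
  proof (cases j)
    case 0
    have "L $$ (i, 0) + (\<Sum>k<r. L $$ (i, Suc k)) = 0"
      using rows[OF i] by (simp add: sum.lessThan_Suc_shift del: sum.lessThan_Suc)
    then have "L $$ (i, 0) = - (\<Sum>k<r. L $$ (i, Suc k))" by (simp add: eq_neg_iff_add_eq_0)
    then show ?thesis using 0 by (simp add: sum_negf)
  next
    case (Suc l)
    then have "(\<Sum>k<r. L $$ (i, Suc k) * (of_bool (j = Suc k) - of_bool (j = 0))) = (\<Sum>k<r. if k = l then L $$ (i, Suc k) else 0)"
      by (intro sum.cong) auto
    then show ?thesis using Suc j by simp
  qed
  finally show "(tail_columns L * difference_mat r) $$ (i, j) = L $$ (i, j)" .
qed (use L in \<open>auto simp: tail_columns_def difference_mat_def\<close>)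

lemma difference_mat_tail_columns:
  fixes L :: "'a :: comm_ring_1 mat"
  assumes L: "L \<in> carrier_mat (Suc r) (Suc r)"
  shows "difference_mat r * tail_columns L = reduced_laplacian L"
proof (rule eq_matI)
  fix i j assume "i < dim_row (reduced_laplacian L)" "j < dim_col (reduced_laplacian L)"
  then have "i < r" "j < r" using L by (auto simp: reduced_laplacian_def)
  then show "(difference_mat r * tail_columns L) $$ (i, j) = reduced_laplacian L $$ (i, j)"
    using L by (subst difference_mat_mult[of _ r r]) (auto simp: reduced_laplacian_def tail_columns_def)
qed (use L in \<open>auto simp: tail_columns_def difference_mat_def reduced_laplacian_def\<close>)

lemma difference_mat_intertwines:
  fixes L :: "'a :: comm_ring_1 mat"
  assumes L: "L \<in> carrier_mat (Suc r) (Suc r)" and rows: "\<And>i. i < Suc r \<Longrightarrow> (\<Sum>k<Suc r. L $$ (i, k)) = 0"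
  shows "difference_mat r * L = reduced_laplacian L * difference_mat r"
  unfolding difference_mat_tail_columns[OF L, symmetric]
  using L by (simp add: assoc_mult_mat[of _ r "Suc r" _ r _ "Suc r"] tail_columns_difference_mat[OF L rows])

text \<open>
  The constant vector spans a kernel direction of \<open>L\<close>. In the basis of this vector and the unit
  vectors other than the first, \<open>L\<close> is block triangular with diagonal blocks 0 and the reduced Laplacian.
\<close>

lemma char_poly_reduced_laplacian:
  fixes L :: "'a :: idom mat"
  assumes L: "L \<in> carrier_mat (Suc r) (Suc r)" and rows: "\<And>i. i < Suc r \<Longrightarrow> (\<Sum>k<Suc r. L $$ (i, k)) = 0"
  shows "char_poly L = [:0, 1:] * char_poly (reduced_laplacian L)"
proof -
  define one where "one = (Matrix.mat r 1 (\<lambda>_. 1) :: 'a mat)"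
  define l where "l = Matrix.mat 1 r (\<lambda>(i, j). L $$ (0, Suc j))"
  let ?B = "reduced_laplacian L"
  let ?T = "four_block_mat (1\<^sub>m 1) (0\<^sub>m 1 r) one (1\<^sub>m r)"
  let ?Ti = "four_block_mat (1\<^sub>m 1) (0\<^sub>m 1 r) (- one) (1\<^sub>m r)"
  let ?F = "four_block_mat (0\<^sub>m 1 1) l (0\<^sub>m r 1) ?B"
  have c: "one \<in> carrier_mat r 1" "l \<in> carrier_mat 1 r" "?B \<in> carrier_mat r r"
    using L by (auto simp: one_def l_def)
  have z: "one + - one = 0\<^sub>m r 1" "- one + one = 0\<^sub>m r 1"
    "1\<^sub>m 1 + - 0\<^sub>m 1 1 = (1\<^sub>m 1 :: 'a mat)" using c by (auto intro!: eq_matI)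
  have inv: "?T * ?Ti = 1\<^sub>m (Suc r)" "?Ti * ?T = 1\<^sub>m (Suc r)"
    using c z by (simp_all add: mult_four_block_mat[of _ 1 1 _ r _ r _ _ 1 _ r])
  have TF: "?T * ?F = four_block_mat (0\<^sub>m 1 1) l (0\<^sub>m r 1) (one * l + ?B)"
    using c by (simp add: mult_four_block_mat[of _ 1 1 _ r _ r _ _ 1 _ r])
  have "?T * ?F * ?Ti = four_block_mat (0\<^sub>m 1 1 * 1\<^sub>m 1 + l * - one) (0\<^sub>m 1 1 * 0\<^sub>m 1 r + l * 1\<^sub>m r)
      (0\<^sub>m r 1 * 1\<^sub>m 1 + (one * l + ?B) * - one) (0\<^sub>m r 1 * 0\<^sub>m 1 r + (one * l + ?B) * 1\<^sub>m r)"
    unfolding TF using c by (intro mult_four_block_mat) auto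
  also have "\<dots> = four_block_mat (l * - one) l ((one * l + ?B) * - one) (one * l + ?B)"
  proof -
    have "0\<^sub>m r 1 + - ((one * l + ?B) * one) = - ((one * l + ?B) * one)"
      by (rule left_add_zero_mat) (use c in auto)
    then show ?thesis using c by simp
  qed
  also have "\<dots> = L"
  proof (rule eq_matI)
    fix i j assume "i < dim_row L" "j < dim_col L"
    then have i: "i < Suc r" and j: "j < Suc r" using L by auto
    have ent: "(one * l + ?B) $$ (i, j) = L $$ (Suc i, Suc j)" if "i < r" "j < r" for i j
      using that c L by (simp add: one_def l_def scalar_prod_def reduced_laplacian_def)
    have row: "- (\<Sum>k<r. L $$ (i, Suc k)) = L $$ (i, 0)" if "i < Suc r" for i
      using rows[OF that] by (simp add: sum.lessThan_Suc_shift neg_eq_iff_add_eq_0 add.commute del: sum.lessThan_Suc)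
    have left0: "(l * - one) $$ (0, 0) = L $$ (0, 0)"
      using row[of 0] c by (simp add: one_def l_def scalar_prod_def sum_negf lessThan_atLeast0)
    have left: "((one * l + ?B) * - one) $$ (i, 0) = L $$ (Suc i, 0)" if "i < r" for i
    proof -
      have "(X * - one) $$ (i, 0) = (\<Sum>k<r. X $$ (i, k) * (- one) $$ (k, 0))"
        if "X \<in> carrier_mat r r" for X
        using that \<open>i < r\<close> by (simp add: scalar_prod_def lessThan_atLeast0 one_def sum_negf)
      then have "((one * l + ?B) * - one) $$ (i, 0) = (\<Sum>k<r. (one * l + ?B) $$ (i, k) * (- one) $$ (k, 0))"
        using c by simp
      also have "\<dots> = (\<Sum>k<r. - L $$ (Suc i, Suc k))"
      proof (rule sum.cong[OF refl])
        fix k assume k: "k \<in> {..<r}"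
        then have "(- one) $$ (k, 0) = -1" by (simp add: one_def)
        then show "(one * l + ?B) $$ (i, k) * (- one) $$ (k, 0) = - L $$ (Suc i, Suc k)"
          using ent[OF that, of k] k by simp
      qed
      finally show ?thesis using row[of "Suc i"] that by (simp add: sum_negf)
    qed
    show "four_block_mat (l * - one) l ((one * l + ?B) * - one) (one * l + ?B) $$ (i, j) = L $$ (i, j)"
      using i j c left0 left[of "i - 1"] ent[of "i - 1" "j - 1"]
      by (cases i; cases j) (auto simp: l_def)
  qed (use c(1,2) carrier_matD[OF c(3)] L in auto)
  finally have "L = ?T * ?F * ?Ti" ..
  then have "similar_mat L ?F"
  proof (intro similar_matI[where n = "Suc r" and P = ?T and Q = ?Ti] inv)
    have "?F \<in> carrier_mat (1 + r) (1 + r)" "?T \<in> carrier_mat (1 + r) (1 + r)" "?Ti \<in> carrier_mat (1 + r) (1 + r)"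
      using c by (auto intro!: four_block_carrier_mat simp del: One_nat_def)
    then show "{L, ?F, ?T, ?Ti} \<subseteq> carrier_mat (Suc r) (Suc r)" using L by simp
  qed
  then have "char_poly L = char_poly ?F" by (rule char_poly_similar)
  also have "\<dots> = char_poly (0\<^sub>m 1 1) * char_poly ?B"
    using c by (intro char_poly_four_block_zeros_col) auto
  also have "char_poly (0\<^sub>m 1 1 :: 'a mat) = [:0, 1:]"
    by (subst char_poly_upper_triangular[of _ 1]) (auto simp: diag_mat_def)
  finally show ?thesis .
qed

lemma laplacian_carrier [simp]: "laplacian N a \<in> carrier_mat N N"
  by (simp add: laplacian_def)

lemma laplacian_mult:
  assumes "i < N"
  shows "(\<Sum>k<N. laplacian N a $$ (i, k) * x k) = (\<Sum>k\<in>{..<N} - {i}. a i k * (x i - x k))"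
proof -
  have "(\<Sum>k<N. laplacian N a $$ (i, k) * x k) = laplacian N a $$ (i, i) * x i + (\<Sum>k\<in>{..<N} - {i}. laplacian N a $$ (i, k) * x k)"
    using assms by (intro sum.remove) auto
  also have "(\<Sum>k\<in>{..<N} - {i}. laplacian N a $$ (i, k) * x k) = (\<Sum>k\<in>{..<N} - {i}. - a i k * x k)"
    using assms by (intro sum.cong) (auto simp: laplacian_def)
  finally show ?thesis using assms
    by (simp add: laplacian_def sum_distrib_right sum_negf sum_subtractf right_diff_distrib)
qed

lemma laplacian_row_sum: "i < N \<Longrightarrow> (\<Sum>k<N. laplacian N a $$ (i, k)) = 0"
  using laplacian_mult[of i N a "\<lambda>_. 1"] by simp

text \<open>
  At a maximum of \<open>x\<close> the Laplacian of \<open>x\<close> is nonnegative and at a minimum nonpositive, so the constant value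
  is 0. Then a maximum at \<open>i\<close> forces the same value at all nodes with an edge into \<open>i\<close>, and so at every
  node from which \<open>i\<close> can be reached.
\<close>

lemma maximum_principle:
  fixes x :: "nat \<Rightarrow> real"
  assumes sc: "strongly_connected (weight_digraph N a)"
    and weights: "\<And>i k. i < N \<Longrightarrow> k < N \<Longrightarrow> a i k \<ge> 0"
    and const: "\<And>i. i < N \<Longrightarrow> (\<Sum>k<N. laplacian N a $$ (i, k) * x k) = \<alpha>"
    and u: "u < N" and v: "v < N"
  shows "x u = x v"
proof -
  have lap: "(\<Sum>k\<in>{..<N} - {i}. a i k * (x i - x k)) = \<alpha>" if "i < N" for i
    using const[OF that] laplacian_mult[OF that] by simp
  have ne: "x ` {..<N} \<noteq> {}" using u by auto
  obtain M where M: "M < N" "\<And>i. i < N \<Longrightarrow> x i \<le> x M"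
    using Max_in[OF _ ne] Max_ge[of "x ` {..<N}"] by (metis (no_types, lifting) finite_imageI finite_lessThan imageE imageI lessThan_iff)
  obtain m where m: "m < N" "\<And>i. i < N \<Longrightarrow> x m \<le> x i"
    using Min_in[OF _ ne] Min_le[of "x ` {..<N}"] by (metis (no_types, lifting) finite_imageI finite_lessThan imageE imageI lessThan_iff)
  have "\<alpha> \<ge> 0"
    unfolding lap[OF M(1), symmetric] using M weights by (intro sum_nonneg) auto
  moreover have "\<alpha> \<le> 0"
    unfolding lap[OF m(1), symmetric] using m weights by (intro sum_nonpos) (auto simp: mult_nonneg_nonpos)
  ultimately have \<alpha>: "\<alpha> = 0" by simp
  have all: "x w = x M" if "w < N" for w
  proof -
    interpret wf_digraph "weight_digraph N a"
      by unfold_locales (auto simp: weight_digraph_def)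
    have V: "verts (weight_digraph N a) = {..<N}" by (simp add: weight_digraph_def)
    have "w \<rightarrow>\<^sup>*\<^bsub>weight_digraph N a\<^esub> M"
      using sc that M(1) unfolding strongly_connected_def V by auto
    then show ?thesis
    proof (induction rule: converse_reachable_induct)
      case (step k i)
      then have e: "k < N" "i < N" "a i k > 0"
        by (auto simp: weight_digraph_def arcs_ends_def arc_to_ends_def)
      have "(\<Sum>k\<in>{..<N} - {i}. a i k * (x i - x k)) = 0" using lap e \<alpha> by simp
      moreover have "\<forall>k\<in>{..<N} - {i}. 0 \<le> a i k * (x i - x k)"
        using weights e M(2) step.IH by auto
      ultimately have "\<forall>k\<in>{..<N} - {i}. a i k * (x i - x k) = 0"
        by (subst (asm) sum_nonneg_eq_0_iff) auto
      then have "k \<noteq> i \<Longrightarrow> a i k * (x i - x k) = 0" using e(1) by blast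
      then show ?case using e step.IH by (cases "k = i") auto
    qed auto
  qed
  show ?thesis using all u v by simp
qed

text \<open>
  A kernel vector, extended by 0 at node 0, has constant image under the Laplacian, so it is constant
  by the maximum principle. Equivalently: 0 is a simple eigenvalue of the Laplacian.
\<close>

lemma det_reduced_laplacian:
  assumes sc: "strongly_connected (weight_digraph (Suc r) a)"
    and weights: "\<And>i k. i < Suc r \<Longrightarrow> k < Suc r \<Longrightarrow> a i k \<ge> 0"
  shows "Determinant.det (reduced_laplacian (laplacian (Suc r) a)) \<noteq> 0"
proof
  let ?L = "laplacian (Suc r) a"
  assume "Determinant.det (reduced_laplacian ?L) = 0"
  then obtain y where y: "y \<in> carrier_vec r" "y \<noteq> 0\<^sub>v r" "reduced_laplacian ?L *\<^sub>v y = 0\<^sub>v r"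
    using det_0_iff_vec_prod_zero[of "reduced_laplacian ?L" r] by auto
  define x where "x k = (case k of 0 \<Rightarrow> 0 | Suc j \<Rightarrow> y $ j)" for k
  have Lx: "(\<Sum>k<Suc r. ?L $$ (i, k) * x k) = (\<Sum>j<r. ?L $$ (i, Suc j) * y $ j)" for i
    by (simp add: sum.lessThan_Suc_shift x_def del: sum.lessThan_Suc)
  have "(\<Sum>k<Suc r. ?L $$ (Suc i, k) * x k) = (\<Sum>k<Suc r. ?L $$ (0, k) * x k)" if "i < r" for i
  proof -
    have "0 = (reduced_laplacian ?L *\<^sub>v y) $ i" using y that by simp
    also have "\<dots> = (\<Sum>j<r. (?L $$ (Suc i, Suc j) - ?L $$ (0, Suc j)) * y $ j)"
      using y(1) that by (auto simp: reduced_laplacian_def scalar_prod_def lessThan_atLeast0 laplacian_def)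
    finally show ?thesis unfolding Lx by (simp add: left_diff_distrib sum_subtractf)
  qed
  then have "(\<Sum>k<Suc r. ?L $$ (i, k) * x k) = (\<Sum>k<Suc r. ?L $$ (0, k) * x k)" if "i < Suc r" for i
    using that by (cases i) auto
  then have "x (Suc j) = x 0" if "j < r" for j
    using maximum_principle[OF sc weights, of x _ "Suc j" 0] that by blast
  then have "y = 0\<^sub>v r" using y(1) by (auto simp: x_def)
  then show False using y(2) by simp
qed

section \<open>Linear time-invariant systems\<close>

text \<open>
  The matrix exponential series applied to the initial value, written entrywise: the coefficients are
  \<open>M\<^sup>j x\<^sub>0 / j!\<close>.
\<close>

lemma lti_solution_exists:
  fixes M :: "real mat"
  assumes M: "M \<in> carrier_mat k k" and x0: "x0 \<in> carrier_vec k"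
  obtains x where "lti_solution M x" "x 0 = x0"
proof -
  define v where "v j = ((\<lambda>v. M *\<^sub>v v) ^^ j) x0" for j
  have v: "v j \<in> carrier_vec k" for j by (induction j) (use M x0 in \<open>auto simp: v_def\<close>)
  have vSuc: "v (Suc j) $ i = (\<Sum>l<k. M $$ (i, l) * v j $ l)" if "i < k" for i j
    using that M v[of j] by (simp add: v_def scalar_prod_def lessThan_atLeast0)
  \<comment> \<open>\<open>C\<close> bounds the maximum row sum of \<open>M\<close>, and \<open>b\<close> the entries of the initial value\<close>
  define C where "C = (\<Sum>i<k. \<Sum>l<k. \<bar>M $$ (i, l)\<bar>)"
  define b where "b = (\<Sum>i<k. \<bar>x0 $ i\<bar>)"
  have b0: "0 \<le> b" "0 \<le> C" by (auto simp: b_def C_def intro!: sum_nonneg)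
  have bound: "\<bar>v j $ i\<bar> \<le> C ^ j * b" if "i < k" for i j
    using that
  proof (induction j arbitrary: i)
    case 0
    have "\<bar>x0 $ i\<bar> \<le> b" unfolding b_def by (rule member_le_sum) (use 0 in auto)
    then show ?case by (simp add: v_def)
  next
    case (Suc j)
    have "\<bar>v (Suc j) $ i\<bar> \<le> (\<Sum>l<k. \<bar>M $$ (i, l)\<bar> * \<bar>v j $ l\<bar>)"
      unfolding vSuc[OF Suc.prems] by (rule order_trans[OF sum_abs]) (simp add: abs_mult)
    also have "\<dots> \<le> (\<Sum>l<k. \<bar>M $$ (i, l)\<bar> * (C ^ j * b))"
      using Suc.IH by (intro sum_mono mult_left_mono) auto
    also have "\<dots> = (\<Sum>l<k. \<bar>M $$ (i, l)\<bar>) * (C ^ j * b)" by (simp add: sum_distrib_right)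
    also have "\<dots> \<le> C * (C ^ j * b)"
    proof (rule mult_right_mono)
      show "(\<Sum>l<k. \<bar>M $$ (i, l)\<bar>) \<le> C"
        unfolding C_def by (rule member_le_sum) (use Suc.prems in \<open>auto intro: sum_nonneg\<close>)
    qed (use b0 in auto)
    finally show ?case by simp
  qed
  define c where "c i j = v j $ i / fact j" for i j
  have summ: "summable (\<lambda>j. c i j * t ^ j)" if "i < k" for i t
  proof (rule summable_comparison_test')
    show "summable (\<lambda>j. b * (inverse (fact j) * (C * \<bar>t\<bar>) ^ j))"
      by (intro summable_mult summable_exp)
    show "norm (c i j * t ^ j) \<le> b * (inverse (fact j) * (C * \<bar>t\<bar>) ^ j)" if "j \<ge> 0" for j
    proof -
      have "norm (c i j * t ^ j) = \<bar>v j $ i\<bar> * (\<bar>t\<bar> ^ j * inverse (fact j))"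
        by (simp add: c_def abs_mult power_abs divide_inverse)
      also have "\<dots> \<le> (C ^ j * b) * (\<bar>t\<bar> ^ j * inverse (fact j))"
        using bound[OF \<open>i < k\<close>] by (intro mult_right_mono) auto
      finally show ?thesis by (simp add: power_mult_distrib mult_ac)
    qed
  qed
  define x where "x t = Matrix.vec k (\<lambda>i. \<Sum>j. c i j * t ^ j)" for t
  have der: "((\<lambda>\<tau>. x \<tau> $ i) has_real_derivative (M *\<^sub>v x t) $ i) (at t within {0..})" if i: "i < k" for i t
  proof -
    have "diffs (c i) j = (\<Sum>l<k. M $$ (i, l) * c l j)" for j
    proof -
      have "diffs (c i) j = v (Suc j) $ i / fact j"
        unfolding diffs_def c_def fact_Suc by (simp del: of_nat_Suc)
      then show ?thesis by (simp add: vSuc[OF i] c_def sum_divide_distrib)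
    qed
    then have "(\<Sum>j. diffs (c i) j * t ^ j) = (\<Sum>j. \<Sum>l<k. M $$ (i, l) * (c l j * t ^ j))"
      by (simp add: sum_distrib_right mult.assoc)
    also have "\<dots> = (\<Sum>l<k. \<Sum>j. M $$ (i, l) * (c l j * t ^ j))"
      by (intro suminf_sum summable_mult summ) auto
    also have "\<dots> = (\<Sum>l<k. M $$ (i, l) * x t $ l)"
      by (intro sum.cong refl) (simp add: x_def suminf_mult summ)
    also have "\<dots> = (M *\<^sub>v x t) $ i"
      using M i by (simp add: scalar_prod_def lessThan_atLeast0 x_def)
    finally have "((\<lambda>\<tau>. \<Sum>j. c i j * \<tau> ^ j) has_real_derivative (M *\<^sub>v x t) $ i) (at t)"
      using termdiffs_strong_converges_everywhere[OF summ[OF i], of t] by simp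
    then show ?thesis using i by (simp add: x_def has_field_derivative_at_within)
  qed
  have "lti_solution M x" using der M by (auto simp: lti_solution_def x_def)
  moreover have "x 0 = x0"
  proof (rule eq_vecI)
    fix i assume "i < dim_vec x0"
    then have "x 0 $ i = c i 0" using x0 powser_zero[of "c i"] by (simp add: x_def)
    then show "x 0 $ i = x0 $ i" by (simp add: c_def v_def)
  qed (use x0 in \<open>simp add: x_def\<close>)
  ultimately show ?thesis using that by blast
qed

text \<open>
  After multiplication by \<open>exp (- u t)\<close> the derivative is bounded by that of a multiple of
  \<open>exp (- Re u t)\<close> as soon as the forcing is small; integrate from there.
\<close>

lemma scalar_forced_decay:
  fixes z g :: "real \<Rightarrow> complex"
  assumes der: "\<And>t. t \<ge> 0 \<Longrightarrow> (z has_vector_derivative (u * z t + g t)) (at t within {0..})"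
    and u: "Re u < 0" and g: "(g \<longlongrightarrow> 0) at_top"
  shows "(z \<longlongrightarrow> 0) at_top"
proof (rule tendstoI)
  fix e :: real assume e: "e > 0"
  define al where "al = - Re u"
  have al: "al > 0" using u by (simp add: al_def)
  \<comment> \<open>a forcing of size \<open>d\<close> contributes at most \<open>d / al = e / 2\<close> in the long run\<close>
  define d where "d = e * al / 2"
  have d: "d > 0" using e al by (simp add: d_def)
  obtain T0 where T0: "\<And>t. t \<ge> T0 \<Longrightarrow> norm (g t) < d"
    using tendstoD[OF g d] by (auto simp: eventually_at_top_linorder)
  define T where "T = max T0 0"
  have T: "T \<ge> 0" "\<And>t. t \<ge> T \<Longrightarrow> norm (g t) < d" using T0 by (auto simp: T_def)
  define w where "w t = exp (- u * of_real t) * z t" for t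
  have dw: "(w has_vector_derivative exp (- u * of_real t) * g t) (at t within {0..})" if "t \<ge> 0" for t
  proof -
    have "((\<lambda>t. exp (- u * of_real t)) has_vector_derivative (- u * exp (- u * of_real t))) (at t within {0..})"
      by (rule has_vector_derivative_real_field) (auto intro!: derivative_eq_intros)
    note D = has_vector_derivative_mult[OF this der[OF that]]
    have "E * (u * y + h) + - u * E * y = E * h" for E y h :: complex
      by (simp add: algebra_simps)
    then show ?thesis using D unfolding w_def by (simp only:)
  qed
  have bnd: "norm (w t - w T) \<le> d / al * exp (al * t) - d / al * exp (al * T)" if t: "t > T" for t
  proof (rule differentiable_bound_general[OF t])
    show "continuous_on {T..t} w"
    proof (rule continuous_on_subset)
      show "continuous_on {0..} w" using dw by (intro continuous_on_vector_derivative) auto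
      show "{T..t} \<subseteq> {0..}" using T(1) by auto
    qed
    show "continuous_on {T..t} (\<lambda>s. d / al * exp (al * s))" by (intro continuous_intros)
    fix s assume s: "T < s" "s < t"
    show "(w has_vector_derivative exp (- u * of_real s) * g s) (at s)"
      using dw[of s] s T(1) at_within_interior[of s "{0..}"] by (simp add: interior_Ici[of "-1"])
    show "((\<lambda>s. d / al * exp (al * s)) has_vector_derivative d * exp (al * s)) (at s)"
      using al unfolding has_real_derivative_iff_has_vector_derivative[symmetric]
      by (auto intro!: derivative_eq_intros)
    show "norm (exp (- u * of_real s) * g s) \<le> d * exp (al * s)"
      using T(2)[of s] s by (simp add: norm_mult al_def)
  qed
  have "((\<lambda>t. exp (- al * t) * norm (w T)) \<longlongrightarrow> 0 * norm (w T)) at_top"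
  proof (intro tendsto_mult tendsto_const)
    have "filterlim (\<lambda>t. - al * t) at_bot at_top"
      using al by (intro filterlim_tendsto_neg_mult_at_bot[OF tendsto_const] filterlim_ident) auto
    then show "((\<lambda>t. exp (- al * t)) \<longlongrightarrow> 0) at_top" by (rule filterlim_compose[OF exp_at_bot])
  qed
  then have "\<forall>\<^sub>F t in at_top. exp (- al * t) * norm (w T) < e / 2"
    using e order_tendstoD(2)[of _ 0 at_top "e / 2"] by simp
  moreover have "\<forall>\<^sub>F t in at_top. t > T" by (rule eventually_gt_at_top)
  ultimately show "\<forall>\<^sub>F t in at_top. dist (z t) 0 < e"
  proof eventually_elim
    case (elim t)
    have "norm (w t) \<le> norm (w T) + norm (w t - w T)" by (metis add.commute diff_add_cancel norm_triangle_ineq)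
    also have "\<dots> \<le> norm (w T) + d / al * exp (al * t)"
    proof -
      have "0 \<le> d / al * exp (al * T)" using d al by simp
      then show ?thesis using bnd[OF elim(2)] by linarith
    qed
    finally have nw: "norm (w t) \<le> norm (w T) + d / al * exp (al * t)" .
    have "norm (z t) = exp (- al * t) * norm (w t)"
      by (simp add: w_def norm_mult al_def exp_add[symmetric] mult.assoc[symmetric])
    also have "\<dots> \<le> exp (- al * t) * (norm (w T) + d / al * exp (al * t))"
      using nw by (intro mult_left_mono) auto
    also have "\<dots> = exp (- al * t) * norm (w T) + d / al"
      by (simp add: algebra_simps exp_add[symmetric])
    also have "d / al = e / 2" using al by (simp add: d_def)
    finally show ?case using elim(1) by simp
  qed
qed

text \<open>
  Back substitution: the last component decays by itself, and each earlier one is forced by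
  components already known to decay.
\<close>

lemma upper_triangular_decay:
  fixes z :: "nat \<Rightarrow> real \<Rightarrow> complex"
  assumes U: "U \<in> carrier_mat k k" "upper_triangular U" "\<And>i. i < k \<Longrightarrow> Re (U $$ (i, i)) < 0"
    and der: "\<And>i t. i < k \<Longrightarrow> t \<ge> 0 \<Longrightarrow>
      (z i has_vector_derivative (\<Sum>l<k. U $$ (i, l) * z l t)) (at t within {0..})"
    and i: "i < k"
  shows "(z i \<longlongrightarrow> 0) at_top"
  using i
proof (induction "k - i" arbitrary: i rule: less_induct)
  case less
  have IH: "(z l \<longlongrightarrow> 0) at_top" if "i < l" "l < k" for l
    using less.hyps[of l] that by auto
  have split: "(\<Sum>l<k. U $$ (i, l) * z l t) = U $$ (i, i) * z i t + (\<Sum>l\<in>{i<..<k}. U $$ (i, l) * z l t)" for t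
  proof -
    have "(\<Sum>l<k. U $$ (i, l) * z l t) = (\<Sum>l\<in>insert i {i<..<k}. U $$ (i, l) * z l t)"
      using less.prems U by (intro sum.mono_neutral_right) (auto simp: upper_triangular_def)
    then show ?thesis by simp
  qed
  show ?case
  proof (rule scalar_forced_decay)
    show "(z i has_vector_derivative (U $$ (i, i) * z i t + (\<Sum>l\<in>{i<..<k}. U $$ (i, l) * z l t))) (at t within {0..})"
      if "t \<ge> 0" for t using der[OF less.prems that] split by simp
    show "((\<lambda>t. \<Sum>l\<in>{i<..<k}. U $$ (i, l) * z l t) \<longlongrightarrow> 0) at_top"
      by (rule tendsto_null_sum, rule tendsto_mult_right_zero, rule IH) auto
  qed (use U less.prems in auto)
qed

lemma lti_linear_functional:
  fixes M :: "real mat" and Q :: "complex mat"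
  assumes M: "M \<in> carrier_mat k k" and x: "lti_solution M x" and Q: "Q \<in> carrier_mat q k"
    and i: "i < q" and t: "t \<ge> 0"
  shows "((\<lambda>\<tau>. \<Sum>l<k. Q $$ (i, l) * of_real (x \<tau> $ l)) has_vector_derivative
    (\<Sum>l<k. (Q * cmat M) $$ (i, l) * of_real (x t $ l))) (at t within {0..})"
proof -
  have xt: "x t \<in> carrier_vec k" and d: "\<And>l. l < k \<Longrightarrow>
    ((\<lambda>\<tau>. x \<tau> $ l) has_real_derivative (M *\<^sub>v x t) $ l) (at t within {0..})"
    using x M t by (auto simp: lti_solution_def)
  have "((\<lambda>\<tau>. \<Sum>l<k. Q $$ (i, l) * of_real (x \<tau> $ l)) has_vector_derivative
    (\<Sum>l<k. Q $$ (i, l) * of_real ((M *\<^sub>v x t) $ l))) (at t within {0..})"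
    by (intro has_vector_derivative_sum has_vector_derivative_mult_right has_vector_derivative_of_real d) auto
  also have "(\<Sum>l<k. Q $$ (i, l) * of_real ((M *\<^sub>v x t) $ l)) = (\<Sum>l<k. \<Sum>j<k. Q $$ (i, l) * (of_real (M $$ (l, j)) * of_real (x t $ j)))"
    using M xt by (intro sum.cong) (auto simp: scalar_prod_def lessThan_atLeast0 sum_distrib_left)
  also have "\<dots> = (\<Sum>j<k. \<Sum>l<k. Q $$ (i, l) * (of_real (M $$ (l, j)) * of_real (x t $ j)))"
    by (rule sum.swap)
  also have "\<dots> = (\<Sum>j<k. (Q * cmat M) $$ (i, j) * of_real (x t $ j))"
    using M Q i by (intro sum.cong) (auto simp: scalar_prod_def lessThan_atLeast0 sum_distrib_right mult.assoc)
  finally show ?thesis .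
qed

lemma hurwitz_decay:
  fixes M :: "real mat"
  assumes M: "M \<in> carrier_mat k k" and h: "hurwitz (cmat M)" and x: "lti_solution M x" and i: "i < k"
  shows "((\<lambda>t. x t $ i) \<longlongrightarrow> 0) at_top"
proof -
  have cM: "cmat M \<in> carrier_mat k k" using M by auto
  obtain es where es: "char_poly (cmat M) = (\<Prod>e\<leftarrow>es. [:- e, 1:])" using char_poly_factorized[OF cM] by auto
  obtain U S T where "schur_decomposition (cmat M) es = (U, S, T)" by (cases "schur_decomposition (cmat M) es") auto
  from schur_decomposition[OF cM es this]
  have sim: "similar_mat_wit (cmat M) U S T" and ut: "upper_triangular U" and dg: "diag_mat U = es" by auto
  note w = similar_mat_witD2[OF cM sim]
  have TM: "T * cmat M = U * T"
  proof -
    have "S * U * T = S * (U * T)" using w by (intro assoc_mult_mat[of _ k k _ k _ k])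
    moreover have "T * (S * (U * T)) = T * S * (U * T)"
      using w by (intro assoc_mult_mat[of _ k k _ k _ k, symmetric]) auto
    ultimately have "T * cmat M = 1\<^sub>m k * (U * T)" unfolding w(3) by (simp only: w(2))
    then show ?thesis using w by simp
  qed
  have dU: "Re (U $$ (i, i)) < 0" if "i < k" for i
  proof -
    have "U $$ (i, i) \<in> set es" using that w(5) dg by (auto simp: diag_mat_def)
    then have "poly (char_poly (cmat M)) (U $$ (i, i)) = 0"
      unfolding es poly_prod_list by (auto simp: prod_list_zero_iff image_iff o_def intro!: bexI[of _ "U $$ (i, i)"])
    then show ?thesis using h eigenvalue_root_char_poly[OF cM] by (auto simp: hurwitz_def)
  qed
  define z where "z i t = (\<Sum>l<k. T $$ (i, l) * of_real (x t $ l))" for i t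
  have dec: "(z i \<longlongrightarrow> 0) at_top" if "i < k" for i
  proof (rule upper_triangular_decay[OF w(5) ut dU _ that])
    fix i :: nat and t :: real assume i: "i < k" and t: "t \<ge> 0"
    have "(z i has_vector_derivative (\<Sum>l<k. (U * T) $$ (i, l) * of_real (x t $ l))) (at t within {0..})"
      using lti_linear_functional[OF M x w(7) i t] unfolding z_def TM .
    also have "(\<Sum>l<k. (U * T) $$ (i, l) * of_real (x t $ l)) = (\<Sum>l<k. \<Sum>j<k. U $$ (i, j) * (T $$ (j, l) * of_real (x t $ l)))"
      using w i by (intro sum.cong) (auto simp: scalar_prod_def lessThan_atLeast0 sum_distrib_right mult.assoc)
    also have "\<dots> = (\<Sum>j<k. U $$ (i, j) * z j t)"
      unfolding z_def by (subst sum.swap) (simp add: sum_distrib_left)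
    finally show "(z i has_vector_derivative (\<Sum>l<k. U $$ (i, l) * z l t)) (at t within {0..})" .
  qed
  have recover: "of_real (x t $ i) = (\<Sum>l<k. S $$ (i, l) * z l t)" for t
  proof -
    have "(\<Sum>l<k. S $$ (i, l) * z l t) = (\<Sum>j<k. \<Sum>l<k. S $$ (i, l) * (T $$ (l, j) * of_real (x t $ j)))"
      unfolding z_def by (subst sum.swap) (simp add: sum_distrib_left)
    also have "\<dots> = (\<Sum>j<k. (S * T) $$ (i, j) * of_real (x t $ j))"
      using w(4-7) i by (intro sum.cong) (auto simp: scalar_prod_def lessThan_atLeast0 sum_distrib_right mult.assoc)
    also have "\<dots> = (\<Sum>j<k. if j = i then of_real (x t $ j) else 0)"
      unfolding w(1) using i by (intro sum.cong) auto
    finally show ?thesis using i by simp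
  qed
  have "((\<lambda>t. \<Sum>l<k. S $$ (i, l) * z l t) \<longlongrightarrow> 0) at_top"
    by (rule tendsto_null_sum, rule tendsto_mult_right_zero, rule dec) auto
  then have "((\<lambda>t. complex_of_real (x t $ i)) \<longlongrightarrow> of_real 0) at_top" by (simp add: recover)
  then show ?thesis unfolding tendsto_of_real_iff .
qed

text \<open>
  A left eigenvector \<open>w\<close> for an unstable eigenvalue turns a trajectory into the scalar function
  \<open>w\<^sup>T x (t) = exp (\<mu> t) w\<^sup>T x (0)\<close>, which does not decay if the initial value is a unit vector on which
  \<open>w\<close> is nonzero.
\<close>

lemma decay_imp_hurwitz:
  fixes M :: "real mat"
  assumes M: "M \<in> carrier_mat k k"
    and dec: "\<And>p. p < k \<Longrightarrow> \<exists>x. lti_solution M x \<and> x 0 = unit_vec k p \<and> (\<forall>i<k. ((\<lambda>t. x t $ i) \<longlongrightarrow> 0) at_top)"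
  shows "hurwitz (cmat M)"
  unfolding hurwitz_def
proof (intro allI impI, rule ccontr)
  fix mu assume ev: "eigenvalue (cmat M) mu" and neg: "\<not> Re mu < 0"
  have cM: "cmat M \<in> carrier_mat k k" "transpose_mat (cmat M) \<in> carrier_mat k k" using M by auto
  have "eigenvalue (transpose_mat (cmat M)) mu"
    using ev eigenvalue_root_char_poly[OF cM(1)] eigenvalue_root_char_poly[OF cM(2)] char_poly_transpose_mat[OF cM(1)] by simp
  then obtain w where w: "w \<in> carrier_vec k" "w \<noteq> 0\<^sub>v k" "transpose_mat (cmat M) *\<^sub>v w = mu \<cdot>\<^sub>v w"
    using M by (auto simp: eigenvalue_def eigenvector_def)
  obtain p where p: "p < k" "w $ p \<noteq> 0" using w(1,2) by (metis eq_vecI carrier_vecD index_zero_vec(1) index_zero_vec(2))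
  obtain x where x: "lti_solution M x" "x 0 = unit_vec k p" "\<And>i. i < k \<Longrightarrow> ((\<lambda>t. x t $ i) \<longlongrightarrow> 0) at_top"
    using dec[OF p(1)] by blast
  define Q where "Q = Matrix.mat 1 k (\<lambda>(i, l). w $ l)"
  have Q: "Q \<in> carrier_mat 1 k" by (simp add: Q_def)
  have QM: "(Q * cmat M) $$ (0, l) = mu * w $ l" if "l < k" for l
  proof -
    have "(Q * cmat M) $$ (0, l) = (transpose_mat (cmat M) *\<^sub>v w) $ l"
      using that M w(1) by (auto simp: Q_def scalar_prod_def mult.commute)
    then show ?thesis using w that by simp
  qed
  define f where "f t = (\<Sum>l<k. w $ l * of_real (x t $ l))" for t
  have df: "(f has_vector_derivative mu * f t) (at t within {0..})" if "t \<ge> 0" for t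
    using lti_linear_functional[OF M x(1) Q _ that, of 0] QM
    unfolding f_def by (simp add: Q_def sum_distrib_left mult.assoc)
  have "((\<lambda>t. exp (- mu * of_real t) * f t) has_vector_derivative 0) (at t within {0..})" if "t \<in> {0..}" for t
  proof -
    have "((\<lambda>t. exp (- mu * of_real t)) has_vector_derivative (- mu * exp (- mu * of_real t))) (at t within {0..})"
      by (rule has_vector_derivative_real_field) (auto intro!: derivative_eq_intros)
    note D = has_vector_derivative_mult[OF this df]
    have "E * (mu * y) + - mu * E * y = 0" for E y :: complex by simp
    then show ?thesis using D that by (simp only: atLeast_iff)
  qed
  then obtain c where c: "\<And>t. t \<in> {0..} \<Longrightarrow> exp (- mu * of_real t) * f t = c"
    by (rule has_vector_derivative_zero_constant[rotated]) auto
  have "c = w $ p"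
  proof -
    have "f 0 = (\<Sum>l<k. if l = p then w $ l else 0)"
      unfolding f_def x(2) using p by (intro sum.cong) auto
    then show ?thesis using c[of 0] p by simp
  qed
  have "norm (w $ p) \<le> norm (f t)" if "t \<ge> 0" for t
  proof -
    have "norm (w $ p) = norm (exp (- mu * of_real t)) * norm (f t)"
      using c[of t] \<open>c = w $ p\<close> that by (metis atLeast_iff norm_mult)
    also have "\<dots> \<le> 1 * norm (f t)"
      using neg that by (intro mult_right_mono) auto
    finally show ?thesis by simp
  qed
  moreover have "(f \<longlongrightarrow> 0) at_top"
  proof -
    have "((\<lambda>t. complex_of_real (x t $ l)) \<longlongrightarrow> 0) at_top" if "l < k" for l
      using x(3)[OF that] tendsto_of_real[of "\<lambda>t. x t $ l" 0] by simp
    then show ?thesis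
      unfolding f_def by (intro tendsto_null_sum tendsto_mult_right_zero) auto
  qed
  then have "\<forall>\<^sub>F t in at_top. norm (f t) < norm (w $ p)"
    using p(2) tendstoD[of f 0 at_top "norm (w $ p)"] by simp
  then obtain T where "\<And>t. t \<ge> T \<Longrightarrow> norm (f t) < norm (w $ p)"
    by (auto simp: eventually_at_top_linorder)
  then have "norm (f (max T 0)) < norm (w $ p)" by simp
  moreover have "0 \<le> max T 0" by simp
  ultimately show False by (meson not_le)
qed

section \<open>Winding numbers along the Nyquist contour\<close>

text \<open>
  On the unit interval both paths have continuous logarithms, and the winding number of an exponential
  is the increment of the exponent.
\<close>

lemma winding_number_mult:
  assumes p: "path p" "pathfinish p = pathstart p" "0 \<notin> path_image p"
    and q: "path q" "pathfinish q = pathstart q" "0 \<notin> path_image q"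
  shows "winding_number (\<lambda>t. p t * q t) 0 = winding_number p 0 + winding_number q 0"
proof -
  have log: "\<exists>g. path g \<and> (\<forall>t\<in>{0..1}. r t = exp (g t))" if "path r" "0 \<notin> path_image r" for r :: "real \<Rightarrow> complex"
  proof -
    have "continuous_on {0..1} r" "contractible {0..1::real}" "\<And>t. t \<in> {0..1} \<Longrightarrow> r t \<noteq> 0"
      using that by (auto simp: path_def path_image_def convex_imp_contractible)
    from continuous_logarithm_on_contractible[OF this] show ?thesis
      unfolding path_def by metis
  qed
  obtain g where g: "path g" "\<And>t. t \<in> {0..1} \<Longrightarrow> p t = exp (g t)" using log p by blast
  obtain h where h: "path h" "\<And>t. t \<in> {0..1} \<Longrightarrow> q t = exp (h t)" using log q by blast
  have gh: "path (\<lambda>t. g t + h t)"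
    using g(1) h(1) unfolding path_def by (intro continuous_intros)
  have 1: "winding_number p 0 = winding_number (exp \<circ> g) 0"
    using g(2) by (intro winding_number_cong) auto
  have 2: "winding_number q 0 = winding_number (exp \<circ> h) 0"
    using h(2) by (intro winding_number_cong) auto
  have "winding_number (\<lambda>t. p t * q t) 0 = winding_number (exp \<circ> (\<lambda>t. g t + h t)) 0"
    using g(2) h(2) by (intro winding_number_cong) (auto simp: exp_add)
  also have "\<dots> = winding_number (exp \<circ> g) 0 + winding_number (exp \<circ> h) 0"
    unfolding winding_number_compose_exp[OF g(1)] winding_number_compose_exp[OF h(1)]
      winding_number_compose_exp[OF gh]
    by (simp add: pathfinish_def pathstart_def add_divide_distrib diff_divide_distrib)
  finally show ?thesis unfolding 1 2 .
qed

lemma winding_number_prod_linear_factors: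
  fixes zs :: "complex list"
  assumes g: "path g" "pathfinish g = pathstart g" "set zs \<inter> path_image g = {}"
  shows "path (\<lambda>t. \<Prod>z\<leftarrow>zs. g t - z) \<and> 0 \<notin> path_image (\<lambda>t. \<Prod>z\<leftarrow>zs. g t - z) \<and>
    winding_number (\<lambda>t. \<Prod>z\<leftarrow>zs. g t - z) 0 = (\<Sum>z\<leftarrow>zs. winding_number g z)"
  using g(3)
proof (induction zs)
  case Nil
  then show ?case by (auto simp: path_image_def winding_number_zero_const path_def)
next
  case (Cons z zs)
  then have IH: "path (\<lambda>t. \<Prod>z\<leftarrow>zs. g t - z)" "0 \<notin> path_image (\<lambda>t. \<Prod>z\<leftarrow>zs. g t - z)"
    "winding_number (\<lambda>t. \<Prod>z\<leftarrow>zs. g t - z) 0 = (\<Sum>z\<leftarrow>zs. winding_number g z)" by auto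
  have z: "path (\<lambda>t. g t - z)" "0 \<notin> path_image (\<lambda>t. g t - z)"
    using g(1) Cons.prems unfolding path_def by (auto intro!: continuous_intros simp: path_image_def)
  have "path (\<lambda>t. (g t - z) * (\<Prod>z\<leftarrow>zs. g t - z))"
    using continuous_on_mult z(1) IH(1) unfolding path_def by blast
  moreover have "winding_number (\<lambda>t. (g t - z) * (\<Prod>z\<leftarrow>zs. g t - z)) 0 =
      winding_number (\<lambda>t. g t - z) 0 + winding_number (\<lambda>t. \<Prod>z\<leftarrow>zs. g t - z) 0"
    using z IH g(2) by (intro winding_number_mult) (auto simp: pathfinish_def pathstart_def)
  moreover have "0 \<notin> path_image (\<lambda>t. (g t - z) * (\<Prod>z\<leftarrow>zs. g t - z))"
    using z(2) IH(2) unfolding path_image_def image_iff by (metis mult_eq_0_iff)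
  ultimately show ?case using IH(3) by (simp add: winding_number_offset[of g z])
qed

lemma part_circlepath_Re:
  "part_circlepath 0 R (pi / 2) (- (pi / 2)) t = of_real R * cis (pi / 2 - pi * t)"
  "part_circlepath 0 R (- (pi / 2)) (- (3 * pi / 2)) t = of_real R * cis (- (pi / 2) - pi * t)"
proof -
  have "linepath (pi / 2) (- (pi / 2)) t = pi / 2 - pi * t"
    "linepath (- (pi / 2)) (- (3 * pi / 2)) t = - (pi / 2) - pi * t"
    by (simp_all add: linepath_def field_simps)
  then show "part_circlepath 0 R (pi / 2) (- (pi / 2)) t = of_real R * cis (pi / 2 - pi * t)"
  "part_circlepath 0 R (- (pi / 2)) (- (3 * pi / 2)) t = of_real R * cis (- (pi / 2) - pi * t)"
    unfolding part_circlepath_def cis_conv_exp by simp_all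
qed

text \<open>
  The model with which the indented contour is compared: the left half of the circle, then the
  right half as in the Nyquist contour.
\<close>

lemma winding_number_full_clockwise_circle:
  assumes "0 < R" "norm z < R"
  shows "winding_number (part_circlepath 0 R (- (pi/2)) (- (3*pi/2)) +++ part_circlepath 0 R (pi/2) (- (pi/2))) z = -1"
proof -
  let ?p = "part_circlepath 0 R (- (pi/2)) (- (3*pi/2)) +++ part_circlepath 0 R (pi/2) (- (pi/2))"
  let ?l = "\<lambda>t. of_real (ln R) + \<i> * of_real (- (pi/2) - 2*pi*t)"
  have le: "exp (?l t) = of_real R * cis (- (pi/2) - 2*pi*t)" for t
    using assms(1) unfolding cis_conv_exp exp_add exp_of_real by simp
  have pe: "?p t = exp (?l t)" if "t \<in> {0..1}" for t
  proof (cases "t \<le> 1/2")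
    case True
    then show ?thesis unfolding le joinpaths_def part_circlepath_Re by (simp add: mult.assoc mult.left_commute)
  next
    case False
    have "pi / 2 - pi * (2 * t - 1) = (- (pi/2) - 2*pi*t) + 2 * pi" by (simp add: algebra_simps)
    then have "cis (pi / 2 - pi * (2 * t - 1)) = cis (- (pi/2) - 2*pi*t)"
      by (simp only: cis_mult[symmetric]) simp
    then show ?thesis using False unfolding le joinpaths_def part_circlepath_Re by simp
  qed
  have l: "path ?l" unfolding path_def by (intro continuous_intros)
  have "winding_number ?p 0 = winding_number (exp \<circ> ?l) 0"
    using pe by (intro winding_number_cong) auto
  also have "\<dots> = -1"
    unfolding winding_number_compose_exp[OF l] by (simp add: pathfinish_def pathstart_def field_simps)
  finally have 0: "winding_number ?p 0 = -1" .
  have pi: "path_image ?p \<subseteq> sphere 0 R"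
    using pe assms by (auto simp: path_image_def exp_add exp_of_real norm_mult)
  have "winding_number ?p z = winding_number ?p 0"
  proof (rule winding_number_eq)
    have "part_circlepath 0 R (- (pi/2)) (- (3*pi/2)) 1 = part_circlepath 0 R (pi/2) (- (pi/2)) 0"
      using sin_3over2_pi cos_3over2_pi by (simp add: part_circlepath_Re complex_eq_iff cos_diff sin_diff)
    then show "path ?p"
      by (intro path_join_imp) (auto simp: pathfinish_def pathstart_def)
    show "pathfinish ?p = pathstart ?p"
      by (simp add: pathfinish_def pathstart_def joinpaths_def part_circlepath_Re complex_eq_iff cos_diff sin_diff)
    show "Topological_Spaces.connected (ball (0::complex) R)" by simp
    show "ball 0 R \<inter> path_image ?p = {}" using pi by auto
  qed (use assms in auto)
  then show ?thesis using 0 by simp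
qed

text \<open>
  The depth of the indentation of the Nyquist contour at a point \<open>z\<close> of the imaginary axis.
\<close>

definition indentation :: "complex set \<Rightarrow> real \<Rightarrow> complex \<Rightarrow> real" where
  "indentation P \<epsilon> z = (\<Sum>w\<in>P. sqrt (max 0 (\<epsilon>\<^sup>2 - (dist z w)\<^sup>2)))"

definition indented_axis :: "complex set \<Rightarrow> real \<Rightarrow> real \<Rightarrow> real \<Rightarrow> complex" where
  "indented_axis P \<epsilon> R t = \<i> * of_real (R * (2 * t - 1)) - of_real (indentation P \<epsilon> (\<i> * of_real (R * (2 * t - 1))))"

lemma nyquist_contour_eq:
  "nyquist_contour P \<epsilon> R = indented_axis P \<epsilon> R +++ part_circlepath 0 R (pi / 2) (- (pi / 2))"
proof -
  have "linepath (- (\<i> * complex_of_real R)) (\<i> * complex_of_real R) t = \<i> * of_real (R * (2 * t - 1))" for t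
    by (simp add: linepath_def scaleR_conv_of_real algebra_simps)
  then show ?thesis
    unfolding nyquist_contour_def indented_axis_def indentation_def Let_def by simp
qed

lemma indentation_nonneg: "indentation P \<epsilon> z \<ge> 0"
  by (auto simp: indentation_def intro!: sum_nonneg)

lemma indentation_le: "\<epsilon> \<ge> 0 \<Longrightarrow> indentation P \<epsilon> z \<le> real (card P) * \<epsilon>"
  unfolding indentation_def by (rule sum_bounded_above) (auto intro!: real_le_lsqrt)

lemma indentation_pos:
  assumes "finite P" "z \<in> P" "\<epsilon> > 0"
  shows "indentation P \<epsilon> z > 0"
  unfolding indentation_def by (rule sum_pos2[of _ z]) (use assms in auto)

lemma indentation_eq_0:
  assumes "\<And>w. w \<in> P \<Longrightarrow> \<epsilon> \<le> dist z w" "\<epsilon> \<ge> 0"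
  shows "indentation P \<epsilon> z = 0"
proof -
  have "\<epsilon>\<^sup>2 \<le> (dist z w)\<^sup>2" if "w \<in> P" for w
    using assms that by (intro power_mono) auto
  then show ?thesis unfolding indentation_def by (intro sum.neutral) auto
qed

text \<open>
  Indentation radius and outer radius fit together: the indentations stay inside the
  circle of radius \<open>R\<close>, so that the two pieces of the contour meet at \<open>\<plusminus> \<i> R\<close>.
\<close>

locale indented_contour =
  fixes P :: "complex set" and \<epsilon> R :: real
  assumes finP: "finite P" and eps: "\<epsilon> > 0" and R: "R > 0"
    and Pim: "\<And>w. w \<in> P \<Longrightarrow> Re w = 0 \<and> cmod w + \<epsilon> < R"
begin

lemma indentation_end: "cmod z = R \<Longrightarrow> indentation P \<epsilon> z = 0"
proof (rule indentation_eq_0)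
  fix w assume "cmod z = R" "w \<in> P"
  then show "\<epsilon> \<le> dist z w"
    using Pim[of w] norm_triangle_ineq2[of z w] by (simp add: dist_norm)
qed (use eps in auto)

lemma indented_axis_ends:
  "indented_axis P \<epsilon> R 0 = - (\<i> * R)" "indented_axis P \<epsilon> R 1 = \<i> * R"
  using indentation_end[of "- (\<i> * R)"] indentation_end[of "\<i> * R"] R
  by (simp_all add: indented_axis_def norm_mult)

lemma path_indented_axis: "path (indented_axis P \<epsilon> R)"
  unfolding path_def indented_axis_def indentation_def by (intro continuous_intros)

lemma Re_indented_axis: "Re (indented_axis P \<epsilon> R t) \<le> 0" "Re (indented_axis P \<epsilon> R t) \<ge> - (card P * \<epsilon>)"
  using indentation_nonneg indentation_le eps by (auto simp: indented_axis_def)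

lemma arc_ends:
  "part_circlepath 0 R (pi / 2) (- (pi / 2)) 0 = \<i> * R"
  "part_circlepath 0 R (pi / 2) (- (pi / 2)) 1 = - (\<i> * R)"
  "part_circlepath 0 R (- (pi / 2)) (- (3 * pi / 2)) 0 = - (\<i> * R)"
  "part_circlepath 0 R (- (pi / 2)) (- (3 * pi / 2)) 1 = \<i> * R"
  using sin_3over2_pi cos_3over2_pi
  by (simp_all add: part_circlepath_Re complex_eq_iff sin_diff cos_diff)

lemma path_contour: "path (nyquist_contour P \<epsilon> R)"
  unfolding nyquist_contour_eq
  by (intro path_join_imp path_indented_axis)
     (auto simp: pathfinish_def pathstart_def arc_ends indented_axis_ends)

lemma loop_contour: "pathfinish (nyquist_contour P \<epsilon> R) = pathstart (nyquist_contour P \<epsilon> R)"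
  unfolding nyquist_contour_eq
  by (simp add: pathfinish_def pathstart_def arc_ends indented_axis_ends joinpaths_def)

lemma path_image_contour:
  "path_image (nyquist_contour P \<epsilon> R) =
    indented_axis P \<epsilon> R ` {0..1} \<union> part_circlepath 0 R (pi / 2) (- (pi / 2)) ` {0..1}"
  unfolding nyquist_contour_eq
  by (subst path_image_join) (auto simp: pathfinish_def pathstart_def arc_ends indented_axis_ends path_image_def)

text \<open>
  The indentations are at most \<open>card P * \<epsilon>\<close> deep, so the contour lies in a half-plane, hence in a convex
  set, that does not contain \<open>z\<close>.
\<close>

lemma contour_left:
  assumes "card P * \<epsilon> < - Re z"
  shows "z \<notin> path_image (nyquist_contour P \<epsilon> R)" "winding_number (nyquist_contour P \<epsilon> R) z = 0"
proof -
  let ?S = "{w. Re w \<ge> - (card P * \<epsilon>)}"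
  have cos: "0 \<le> cos (pi / 2 - pi * t)" if "t \<in> {0..1}" for t
    using that by (intro cos_ge_zero) (auto simp: field_simps)
  have sub: "path_image (nyquist_contour P \<epsilon> R) \<subseteq> ?S"
  proof -
    have "- (card P * \<epsilon>) \<le> 0" using eps by simp
    also have "0 \<le> R * cos (pi / 2 - pi * t)" if "t \<in> {0..1}" for t
      using cos[OF that] R by simp
    finally show ?thesis
      unfolding path_image_contour using Re_indented_axis(2) by (auto simp: part_circlepath_Re)
  qed
  have z: "z \<notin> ?S" using assms by auto
  show "z \<notin> path_image (nyquist_contour P \<epsilon> R)" using sub z by blast
  show "winding_number (nyquist_contour P \<epsilon> R) z = 0"
    using winding_number_zero_outside[OF path_contour convex_halfspace_Re_ge loop_contour z sub] .
qed

text \<open>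
  The segment from a point of the indented axis to the corresponding point of the left semicircle stays
  in the closed left half-plane, and meets the imaginary axis only at the common end points or on the indented axis. So
  it avoids \<open>z\<close>, and the contour can be deformed into a full clockwise circle.
\<close>

lemma contour_right:
  assumes z: "cmod z < R" "Re z > 0 \<or> z \<in> P"
  shows "z \<notin> path_image (nyquist_contour P \<epsilon> R)" "winding_number (nyquist_contour P \<epsilon> R) z = -1"
proof -
  let ?g = "indented_axis P \<epsilon> R" and ?a = "part_circlepath 0 R (- (pi / 2)) (- (3 * pi / 2))"
    and ?b = "part_circlepath 0 R (pi / 2) (- (pi / 2))"
  have g: "?g t \<noteq> z" for t
  proof
    assume eq: "?g t = z"
    then have "z \<in> P" using z Re_indented_axis(1)[of t] by auto
    then have "Re (?g t) = 0" using Pim eq by auto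
    then have "indentation P \<epsilon> (\<i> * of_real (R * (2 * t - 1))) = 0" "?g t = \<i> * of_real (R * (2 * t - 1))"
      by (auto simp: indented_axis_def)
    then show False using indentation_pos[OF finP \<open>z \<in> P\<close> eps] eq by simp
  qed
  have b: "?a t \<noteq> z" "?b t \<noteq> z" for t using z R by (auto simp: part_circlepath_Re norm_mult)
  show "z \<notin> path_image (nyquist_contour P \<epsilon> R)"
    unfolding path_image_contour using g b by auto
  \<comment> \<open>the indented axis is pushed linearly onto the left semicircle\<close>
  have "winding_number ?a z = winding_number ?g z"
  proof (rule winding_number_paths_linear_eq)
    fix t :: real assume t: "t \<in> {0..1}"
    show "z \<notin> closed_segment (?g t) (?a t)"
    proof
      assume "z \<in> closed_segment (?g t) (?a t)"
      then obtain u where u: "0 \<le> u" "u \<le> 1" "z = (1 - u) *\<^sub>R ?g t + u *\<^sub>R ?a t"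
        by (auto simp: closed_segment_def)
      have Rea: "Re (?a t) = - (R * sin (pi * t))" by (simp add: part_circlepath_Re cos_diff)
      have sin: "0 \<le> sin (pi * t)" using t by (intro sin_ge_zero) auto
      have 1: "(1 - u) * Re (?g t) \<le> 0" "u * Re (?a t) \<le> 0"
        using u Re_indented_axis(1) Rea sin R by (auto simp: mult_nonneg_nonpos)
      have "Re z = (1 - u) * Re (?g t) + u * Re (?a t)" using u(3) by simp
      moreover have "Re z \<ge> 0" using z(2) Pim by force
      ultimately have "u * Re (?a t) = 0" using 1 by linarith
      moreover have "u \<noteq> 0" using u(3) g[of t] by auto
      ultimately have "sin (pi * t) = 0" using Rea R by simp
      then have "t = 0 \<or> t = 1" using t sin_gt_zero[of "pi * t"] by (cases "t = 0"; cases "t = 1") auto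
      then have "?g t = ?a t" by (auto simp: arc_ends indented_axis_ends)
      then show False using u(3) g[of t] by (simp add: scaleR_left_distrib[symmetric])
    qed
  qed (auto simp: path_indented_axis pathstart_def pathfinish_def arc_ends indented_axis_ends)
  then have "winding_number (nyquist_contour P \<epsilon> R) z = winding_number (?a +++ ?b) z"
    unfolding nyquist_contour_eq using g b
    by (subst (1 2) winding_number_join)
       (auto simp: path_indented_axis pathstart_def pathfinish_def arc_ends indented_axis_ends path_image_def)
  then show "winding_number (nyquist_contour P \<epsilon> R) z = -1"
    using winding_number_full_clockwise_circle[OF R z(1)] by simp
qed

lemma contour_through:
  assumes z: "Re z = 0" "cmod z < R" "\<And>w. w \<in> P \<Longrightarrow> \<epsilon> \<le> dist z w"
  shows "z \<in> path_image (nyquist_contour P \<epsilon> R)"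
proof -
  let ?t = "(Im z / R + 1) / 2"
  have "\<bar>Im z\<bar> < R" using z(2) abs_Im_le_cmod[of z] by linarith
  then have "?t \<in> {0..1}" using R by (auto simp: field_simps)
  moreover have zi: "\<i> * of_real (R * (2 * ?t - 1)) = z" using z(1) R by (simp add: complex_eq_iff field_simps)
  have "indented_axis P \<epsilon> R ?t = z"
    unfolding indented_axis_def zi using indentation_eq_0[OF z(3)] eps by simp
  ultimately show ?thesis unfolding path_image_contour by (metis UnI1 imageI)
qed

end

text \<open>
  Common factors of numerator and denominator are left uncancelled on purpose: a common
  root in the closed right half-plane is counted in \<open>k\<close> as a pole, and it makes the criterion fail as a
  zero. An imaginary zero that is not in \<open>P\<close> lies on the contour and sends the plot through
  the origin; one that is in \<open>P\<close> is enclosed by an indentation.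
\<close>

theorem nyquist_criterion:
  fixes f :: "complex \<Rightarrow> complex" and qs rs :: "complex list"
  assumes f: "\<And>s. s \<notin> set rs \<Longrightarrow> f s = (\<Prod>z\<leftarrow>qs. s - z) / (\<Prod>z\<leftarrow>rs. s - z)"
    and P: "P = {z \<in> set rs. Re z = 0}"
    and k: "k = length (filter (\<lambda>z. Re z \<ge> 0) rs)"
  shows "nyquist_encircles P f k \<longleftrightarrow> (\<forall>z\<in>set qs. Re z < 0)"
proof -
  define D where "D = set qs \<union> set rs"
  have finD: "finite D" and finP: "finite P" by (auto simp: D_def P)
  \<comment> \<open>the radii for which every zero and pole is on the side of the contour where it belongs\<close>
  define good where "good = (\<lambda>(\<epsilon> :: real, R :: real). 0 < \<epsilon> \<and> 0 < R \<and>
    (\<forall>z\<in>D. cmod z + \<epsilon> < R \<and> (Re z < 0 \<longrightarrow> card P * \<epsilon> < - Re z) \<and> (Re z = 0 \<and> z \<notin> P \<longrightarrow> (\<forall>w\<in>P. \<epsilon> \<le> dist z w))))"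
  let ?F = "at_right (0::real) \<times>\<^sub>F (at_top :: real filter)"
  have good: "\<forall>\<^sub>F x in ?F. good x"
  proof -
    have small: "\<forall>\<^sub>F \<epsilon> in at_right (0::real). \<epsilon> < d" if "d > 0" for d
      using that eventually_at_right by blast
    have "\<forall>\<^sub>F \<epsilon> in at_right (0::real). 0 < \<epsilon> \<and> \<epsilon> < 1 \<and>
      (\<forall>z\<in>D. (Re z < 0 \<longrightarrow> card P * \<epsilon> < - Re z) \<and> (Re z = 0 \<and> z \<notin> P \<longrightarrow> (\<forall>w\<in>P. \<epsilon> \<le> dist z w)))"
    proof (intro eventually_conj eventually_ball_finite finD ballI)
      show "\<forall>\<^sub>F \<epsilon> in at_right (0::real). 0 < \<epsilon>" by (simp add: eventually_at_right_less)
      show "\<forall>\<^sub>F \<epsilon> in at_right (0::real). \<epsilon> < 1" using small by simp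
      fix z assume "z \<in> D"
      show "\<forall>\<^sub>F \<epsilon> in at_right (0::real). Re z < 0 \<longrightarrow> card P * \<epsilon> < - Re z"
      proof (cases "Re z < 0")
        case True
        then have "0 < - Re z / (card P + 1)" by (intro divide_pos_pos) auto
        from small[OF this] show ?thesis
        proof (eventually_elim)
          case (elim \<epsilon>)
          then have "(card P + 1) * \<epsilon> < - Re z" by (simp add: field_simps)
          show ?case
          proof (cases "\<epsilon> \<ge> 0")
            case True then show ?thesis using \<open>(card P + 1) * \<epsilon> < - Re z\<close> by (simp add: algebra_simps)
          next
            case False then show ?thesis using True mult_nonneg_nonpos[of "card P" \<epsilon>] by simp
          qed
        qed
      qed auto
      have "\<forall>\<^sub>F \<epsilon> in at_right (0::real). \<epsilon> \<le> dist z w" if "z \<notin> P" "w \<in> P" for w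
      proof -
        have "dist z w > 0" using that by auto
        from small[OF this] show ?thesis by (rule eventually_mono) simp
      qed
      then show "\<forall>\<^sub>F \<epsilon> in at_right (0::real). Re z = 0 \<and> z \<notin> P \<longrightarrow> (\<forall>w\<in>P. \<epsilon> \<le> dist z w)"
        using finP by (cases "z \<in> P") (auto intro: eventually_ball_finite eventually_mono[OF eventually_ball_finite[of P]])
    qed
    moreover have "\<forall>\<^sub>F R in at_top. 0 < R \<and> (\<forall>z\<in>D. cmod z + 1 < R)"
      by (intro eventually_conj eventually_ball_finite finD ballI eventually_gt_at_top)
    ultimately have "\<forall>\<^sub>F x in ?F. (0 < fst x \<and> fst x < 1 \<and>
      (\<forall>z\<in>D. (Re z < 0 \<longrightarrow> card P * fst x < - Re z) \<and> (Re z = 0 \<and> z \<notin> P \<longrightarrow> (\<forall>w\<in>P. fst x \<le> dist z w)))) \<and>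
      (0 < snd x \<and> (\<forall>z\<in>D. cmod z + 1 < snd x))"
      by (rule eventually_prodI)
    then show ?thesis
    proof (rule eventually_mono, goal_cases)
      case (1 x)
      then have "cmod z + fst x < snd x" if "z \<in> D" for z
        using add_strict_left_mono[of "fst x" 1 "cmod z"] less_trans that by blast
      with 1 show ?case by (simp add: good_def case_prod_unfold)
    qed
  qed
  have key: "(0 \<notin> path_image (f \<circ> nyquist_contour P \<epsilon> R) \<and> winding_number (f \<circ> nyquist_contour P \<epsilon> R) 0 = of_nat k)
    \<longleftrightarrow> (\<forall>z\<in>set qs. Re z < 0)" (is "?E \<longleftrightarrow> ?S") if gd: "good (\<epsilon>, R)" for \<epsilon> R
  proof -
    let ?\<gamma> = "nyquist_contour P \<epsilon> R"
    interpret indented_contour P \<epsilon> R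
      using gd finP by unfold_locales (auto simp: good_def D_def P)
    have w: "winding_number ?\<gamma> z = (if Re z \<ge> 0 then -1 else 0)"
      if "z \<in> D" "Re z = 0 \<longrightarrow> z \<in> P" for z
    proof (cases "Re z < 0")
      case True
      then show ?thesis using gd that contour_left(2)[of z] by (auto simp: good_def)
    next
      case False
      have "cmod z + \<epsilon> < R" using gd that(1) unfolding good_def prod.case by blast
      then have "cmod z < R" using eps by linarith
      then show ?thesis using False that contour_right(2)[of z] by force
    qed
    have sum: "(\<Sum>z\<leftarrow>zs. winding_number ?\<gamma> z) = - of_nat (length (filter (\<lambda>z. Re z \<ge> 0) zs))"
      if "set zs \<subseteq> D" "\<forall>z\<in>set zs. Re z = 0 \<longrightarrow> z \<in> P" for zs
      using that by (induction zs) (auto simp: w)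
    have rs: "set rs \<inter> path_image ?\<gamma> = {}"
    proof -
      have "z \<notin> path_image ?\<gamma>" if "z \<in> set rs" for z
      proof (cases "Re z < 0")
        case True
        then show ?thesis using gd that by (intro contour_left) (auto simp: good_def D_def)
      next
        case False
        have "cmod z + \<epsilon> < R" using gd that by (auto simp: good_def D_def)
        then have "cmod z < R" using eps by linarith
        then show ?thesis using False that by (intro contour_right) (auto simp: P)
      qed
      then show ?thesis by auto
    qed
    have wf: "0 \<notin> path_image (f \<circ> ?\<gamma>) \<and> winding_number (f \<circ> ?\<gamma>) 0 = of_nat k - of_nat (length (filter (\<lambda>z. Re z \<ge> 0) qs))"
      if qs: "set qs \<inter> path_image ?\<gamma> = {}"
    proof -
      note q = winding_number_prod_linear_factors[OF path_contour loop_contour qs]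
      note r = winding_number_prod_linear_factors[OF path_contour loop_contour rs]
      let ?q = "\<lambda>t. \<Prod>z\<leftarrow>qs. ?\<gamma> t - z" and ?r = "\<lambda>t. \<Prod>z\<leftarrow>rs. ?\<gamma> t - z"
      have nz: "?q t \<noteq> 0" "?r t \<noteq> 0" if "t \<in> {0..1}" for t
        using q r that unfolding path_image_def by force+
      have ft: "(f \<circ> ?\<gamma>) t = ?q t / ?r t" if "t \<in> {0..1}" for t
      proof -
        have "?\<gamma> t \<notin> set rs" using rs that unfolding path_image_def by blast
        then show ?thesis using f by simp
      qed
      have "path (\<lambda>t. ?q t / ?r t)"
        using q r nz(2) unfolding path_def by (intro continuous_on_divide) auto
      then have pf: "path (f \<circ> ?\<gamma>)"
        unfolding path_def using ft continuous_on_eq by (metis (no_types, lifting))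
      have f0: "0 \<notin> path_image (f \<circ> ?\<gamma>)" using ft nz by (auto simp: path_image_def)
      have lf: "pathfinish (f \<circ> ?\<gamma>) = pathstart (f \<circ> ?\<gamma>)" "pathfinish ?r = pathstart ?r"
        using loop_contour by (auto simp: pathfinish_def pathstart_def)
      have "winding_number (f \<circ> ?\<gamma>) 0 + winding_number ?r 0 = winding_number (\<lambda>t. (f \<circ> ?\<gamma>) t * ?r t) 0"
        using winding_number_mult[OF pf lf(1) f0 _ lf(2)] r by simp
      also have "\<dots> = winding_number ?q 0"
      proof (rule winding_number_cong)
        fix t :: real assume t: "0 \<le> t" "t \<le> 1"
        then show "(f \<circ> ?\<gamma>) t * ?r t = ?q t"
          using iffD1[OF nonzero_eq_divide_eq[OF nz(2)] ft, of t] by simp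
      qed
      finally have "winding_number (f \<circ> ?\<gamma>) 0 + (\<Sum>z\<leftarrow>rs. winding_number ?\<gamma> z) = (\<Sum>z\<leftarrow>qs. winding_number ?\<gamma> z)"
        using q r by simp
      moreover have "z \<in> P" if "z \<in> set qs" "Re z = 0" for z
      proof (rule ccontr)
        assume "z \<notin> P"
        have "cmod z + \<epsilon> < R" "\<forall>w\<in>P. \<epsilon> \<le> dist z w" using gd that \<open>z \<notin> P\<close> by (auto simp: good_def D_def)
        then have "z \<in> path_image ?\<gamma>" using that eps by (intro contour_through) auto
        then show False using qs that by auto
      qed
      ultimately show ?thesis using f0 sum[of rs] sum[of qs] k by (auto simp: D_def P algebra_simps)
    qed
    show ?thesis
    proof
      assume E: ?E
      have "z \<notin> path_image ?\<gamma>" if "z \<in> set qs" for z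
      proof
        assume "z \<in> path_image ?\<gamma>"
        then obtain t where t: "t \<in> {0..1}" "z = ?\<gamma> t" by (auto simp: path_image_def)
        have "z \<notin> set rs" using rs \<open>z \<in> path_image ?\<gamma>\<close> by auto
        then have "f z = 0" using f[of z] that by (auto simp: prod_list_zero_iff)
        then have "0 \<in> path_image (f \<circ> ?\<gamma>)" using t by (force simp: path_image_def)
        then show False using E by simp
      qed
      with wf E have "length (filter (\<lambda>z. Re z \<ge> 0) qs) = 0" by auto
      then show ?S by (auto simp: filter_empty_conv not_le)
    next
      assume S: ?S
      then have "z \<notin> path_image ?\<gamma>" if "z \<in> set qs" for z
        using that gd by (intro contour_left) (auto simp: good_def D_def)
      moreover have "filter (\<lambda>z. Re z \<ge> 0) qs = []" using S by (auto simp: filter_empty_conv not_le)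
      ultimately show ?E using wf by auto
    qed
  qed
  have "?F \<noteq> bot" by (simp add: prod_filter_eq_bot)
  then show ?thesis unfolding nyquist_encircles_def
  proof -
    let ?E = "\<lambda>(\<epsilon>, R). 0 \<notin> path_image (f \<circ> nyquist_contour P \<epsilon> R) \<and> winding_number (f \<circ> nyquist_contour P \<epsilon> R) 0 = of_nat k"
    show "(\<forall>\<^sub>F x in ?F. ?E x) \<longleftrightarrow> (\<forall>z\<in>set qs. Re z < 0)"
    proof
      assume "\<forall>\<^sub>F x in ?F. ?E x"
      with good have "\<forall>\<^sub>F x in ?F. good x \<and> ?E x" by (rule eventually_conj)
      then obtain x where "good x \<and> ?E x" using \<open>?F \<noteq> bot\<close> eventually_happens by blast
      then show "\<forall>z\<in>set qs. Re z < 0" using key by (cases x) auto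
    next
      assume "\<forall>z\<in>set qs. Re z < 0"
      with good show "\<forall>\<^sub>F x in ?F. ?E x" using key by (auto elim!: eventually_mono)
    qed
  qed
qed

section \<open>Consensus and the loop transfer function\<close>

lemma hurwitz_iff_det:
  assumes "X \<in> carrier_mat k k"
  shows "hurwitz X \<longleftrightarrow> (\<forall>s. Determinant.det (s \<cdot>\<^sub>m 1\<^sub>m k - X) = 0 \<longrightarrow> Re s < 0)"
  unfolding hurwitz_def eigenvalue_root_char_poly[OF assms] poly_char_poly[OF assms] ..

lemma lti_solution_intertwine:
  fixes M M' V :: "real mat"
  assumes M: "M \<in> carrier_mat k k" and M': "M' \<in> carrier_mat q q" and V: "V \<in> carrier_mat q k"
    and VM: "V * M = M' * V" and x: "lti_solution M x"
  shows "lti_solution M' (\<lambda>t. V *\<^sub>v x t)"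
  unfolding lti_solution_def
proof (intro allI impI conjI)
  fix t :: real assume t: "t \<ge> 0"
  show "V *\<^sub>v x t \<in> carrier_vec (dim_row M')" using V M' by (auto intro: carrier_vecI)
  fix i assume "i < dim_row M'"
  then have i: "i < q" using M' by auto
  have xt: "x \<tau> \<in> carrier_vec k" if "\<tau> \<ge> 0" for \<tau> using x M that by (auto simp: lti_solution_def)
  have d: "\<And>l. l < k \<Longrightarrow> ((\<lambda>\<tau>. x \<tau> $ l) has_real_derivative (M *\<^sub>v x t) $ l) (at t within {0..})"
    using x M t by (auto simp: lti_solution_def)
  have mv: "(V *\<^sub>v v) $ i = (\<Sum>l<k. V $$ (i, l) * v $ l)" if "v \<in> carrier_vec k" for v
    using that V i by (auto simp: scalar_prod_def lessThan_atLeast0)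
  have "((\<lambda>\<tau>. \<Sum>l<k. V $$ (i, l) * x \<tau> $ l) has_real_derivative (\<Sum>l<k. V $$ (i, l) * (M *\<^sub>v x t) $ l)) (at t within {0..})"
    by (intro DERIV_sum DERIV_cmult d) auto
  also have "(\<Sum>l<k. V $$ (i, l) * (M *\<^sub>v x t) $ l) = (V *\<^sub>v (M *\<^sub>v x t)) $ i"
    by (rule mv[symmetric], rule mult_mat_vec_carrier[OF M xt[OF t]])
  also have "V *\<^sub>v (M *\<^sub>v x t) = M' *\<^sub>v (V *\<^sub>v x t)"
    using assoc_mult_mat_vec[OF V M xt[OF t]] assoc_mult_mat_vec[OF M' V xt[OF t]] VM by simp
  finally show "((\<lambda>\<tau>. (V *\<^sub>v x \<tau>) $ i) has_real_derivative (M' *\<^sub>v (V *\<^sub>v x t)) $ i) (at t within {0..})"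
    by (rule has_field_derivative_transform_within[where d = 1]) (use t mv xt in auto)
qed

lemma block_difference_index:
  fixes v :: "real Matrix.vec"
  assumes v: "v \<in> carrier_vec (Suc r * n)" and p: "p < r * n"
  shows "(kron (difference_mat r) (1\<^sub>m n) *\<^sub>v v) $ p = v $ (n + p) - v $ (p mod n)"
proof -
  have n: "n > 0" using p by (cases n) auto
  note dm = div_mod_less[OF p]
  have c: "difference_mat r \<in> carrier_mat r (Suc r)" by simp
  have "(kron (difference_mat r) (1\<^sub>m n) *\<^sub>v v) $ p =
      (\<Sum>k<Suc r * n. kron (difference_mat r) (1\<^sub>m n) $$ (p, k) * v $ k)"
    using v p by (auto simp: scalar_prod_def lessThan_atLeast0 difference_mat_def)
  also have "\<dots> = (\<Sum>k<Suc r * n. (if k = n + p then v $ k else 0) - (if k = p mod n then v $ k else 0))"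
  proof (rule sum.cong[OF refl])
    fix k assume "k \<in> {..<Suc r * n}"
    then have k: "k < Suc r * n" by simp
    have 1: "k = n + p \<longleftrightarrow> k div n = Suc (p div n) \<and> k mod n = p mod n"
    proof
      assume "k div n = Suc (p div n) \<and> k mod n = p mod n"
      then have "k = Suc (p div n) * n + p mod n" using div_mult_mod_eq[of k n] by simp
      then show "k = n + p" using div_mult_mod_eq[of p n] by simp
    qed (use n in auto)
    have 2: "k = p mod n \<longleftrightarrow> k div n = 0 \<and> k mod n = p mod n"
      using n div_mult_mod_eq[of k n] by (auto simp: div_eq_0_iff)
    have "kron (difference_mat r) (1\<^sub>m n) $$ (p, k) =
        (of_bool (k div n = Suc (p div n)) - of_bool (k div n = 0)) * (of_bool (p mod n = k mod n) :: real)"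
      using p k dm div_mod_less[OF k]
      by (subst kron_index[OF c one_carrier_mat]) (auto simp: difference_mat_def)
    then show "kron (difference_mat r) (1\<^sub>m n) $$ (p, k) * v $ k =
      (if k = n + p then v $ k else 0) - (if k = p mod n then v $ k else 0)"
      unfolding 1 2 by auto
  qed
  also have "\<dots> = v $ (n + p) - v $ (p mod n)"
  proof -
    have "p mod n < Suc r * n" using mod_less_divisor[OF n, of p] by simp
    then show ?thesis using p unfolding sum_subtractf by simp
  qed
  finally show ?thesis .
qed

text \<open>
  The differences with agent 0 form a trajectory of the reduced system, which settles one direction.
  For the other, every unit vector is the difference of some initial state of the network, and that
  state starts a trajectory.
\<close>

lemma consensus_iff_reduced_hurwitz:
  fixes L A W :: "real mat"
  assumes L: "L \<in> carrier_mat (Suc r) (Suc r)" and rows: "\<And>i. i < Suc r \<Longrightarrow> (\<Sum>k<Suc r. L $$ (i, k)) = 0"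
    and A: "A \<in> carrier_mat n n" and W: "W \<in> carrier_mat n n"
  shows "consensus_stable (Suc r) n (kron (1\<^sub>m (Suc r)) A - c \<cdot>\<^sub>m kron L W) \<longleftrightarrow>
    hurwitz (cmat (kron (1\<^sub>m r) A - c \<cdot>\<^sub>m kron (reduced_laplacian L) W))"
proof -
  define M where "M = kron (1\<^sub>m (Suc r)) A - c \<cdot>\<^sub>m kron L W"
  define M' where "M' = kron (1\<^sub>m r) A - c \<cdot>\<^sub>m kron (reduced_laplacian L) W"
  define V where "V = (kron (difference_mat r) (1\<^sub>m n) :: real mat)"
  let ?D = "difference_mat r :: real mat"
  have D: "?D \<in> carrier_mat r (Suc r)" by simp
  note rL = reduction_carrier(1)[OF L]
  have M: "M \<in> carrier_mat (Suc r * n) (Suc r * n)"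
    unfolding M_def by (intro minus_carrier_mat smult_carrier_mat kron_carrier L W)
  have M': "M' \<in> carrier_mat (r * n) (r * n)"
    unfolding M'_def by (intro minus_carrier_mat smult_carrier_mat kron_carrier rL W)
  have V: "V \<in> carrier_mat (r * n) (Suc r * n)"
    unfolding V_def by (intro kron_carrier D one_carrier_mat)
  have VM: "V * M = M' * V"
  proof -
    note k = kron_carrier[OF one_carrier_mat A] kron_carrier[OF L W] kron_carrier[OF rL W]
    have "V * M = V * kron (1\<^sub>m (Suc r)) A - V * (c \<cdot>\<^sub>m kron L W)"
      unfolding M_def by (rule mult_minus_distrib_mat[OF V k(1)]) (use k in auto)
    also have "\<dots> = kron ?D A - c \<cdot>\<^sub>m kron (?D * L) W"
      unfolding mult_smult_distrib[OF V k(2)] unfolding V_def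
      using kron_mult[OF D one_carrier_mat one_carrier_mat A] kron_mult[OF D one_carrier_mat L W] D A W by simp
    also have "?D * L = reduced_laplacian L * ?D" by (rule difference_mat_intertwines[OF L rows])
    also have "kron ?D A - c \<cdot>\<^sub>m kron (reduced_laplacian L * ?D) W = kron (1\<^sub>m r) A * V - (c \<cdot>\<^sub>m kron (reduced_laplacian L) W) * V"
      unfolding mult_smult_assoc_mat[OF k(3) V] unfolding V_def
      using kron_mult[OF one_carrier_mat A D one_carrier_mat] kron_mult[OF rL W D one_carrier_mat] D A W by simp
    also have "\<dots> = M' * V"
      unfolding M'_def by (rule minus_mult_distrib_mat[OF k(1) _ V, symmetric]) (use k in auto)
    finally show ?thesis .
  qed
  have y: "lti_solution M' (\<lambda>t. V *\<^sub>v x t)" if "lti_solution M x" for x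
    using lti_solution_intertwine[OF M M' V VM that] .
  have xt: "x t \<in> carrier_vec (Suc r * n)" if "lti_solution M x" "t \<ge> 0" for x t
    using that M by (auto simp: lti_solution_def)
  have ev: "\<forall>\<^sub>F t in at_top. (V *\<^sub>v x t) $ p = x t $ (n + p) - x t $ (p mod n)"
    if "lti_solution M x" "p < r * n" for x p
    using eventually_ge_at_top[of "0::real"]
    by eventually_elim (use block_difference_index[OF xt[OF that(1)] that(2)] in \<open>simp add: V_def\<close>)
  have "consensus_stable (Suc r) n M \<longleftrightarrow> hurwitz (cmat M')"
  proof
    assume h: "hurwitz (cmat M')"
    show "consensus_stable (Suc r) n M"
      unfolding consensus_stable_def
    proof (intro allI impI)
      fix x i k j assume x: "lti_solution M x" and i: "i < Suc r" and k: "k < Suc r" and j: "j < n"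
      have d: "((\<lambda>t. x t $ (i * n + j) - x t $ j) \<longlongrightarrow> 0) at_top" if i: "i < Suc r" for i
      proof (cases i)
        case (Suc l)
        have "l * n + j < Suc l * n" using j by simp
        also have "\<dots> \<le> r * n" using i Suc by (intro mult_right_mono) auto
        finally have p: "l * n + j < r * n" .
        have e: "\<forall>\<^sub>F t in at_top. (V *\<^sub>v x t) $ (l * n + j) = x t $ (i * n + j) - x t $ j"
          using ev[OF x p] j Suc by (simp add: add.assoc)
        show ?thesis
          using hurwitz_decay[OF M' h y[OF x] p] tendsto_cong[OF e] by simp
      qed simp
      show "((\<lambda>t. x t $ (i * n + j) - x t $ (k * n + j)) \<longlongrightarrow> 0) at_top"
        using tendsto_diff[OF d[OF i] d[OF k]] by simp
    qed
  next
    assume cs: "consensus_stable (Suc r) n M"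
    show "hurwitz (cmat M')"
    proof (rule decay_imp_hurwitz[OF M'])
      fix p assume p: "p < r * n"
      then have n: "n > 0" by (cases n) auto
      obtain x where x: "lti_solution M x" "x 0 = unit_vec (Suc r * n) (n + p)"
        using lti_solution_exists[OF M unit_vec_carrier] by blast
      have "V *\<^sub>v x 0 = unit_vec (r * n) p"
      proof (rule eq_vecI)
        fix q assume "q < dim_vec (unit_vec (r * n) p :: real Matrix.vec)"
        then have q: "q < r * n" by simp
        have qn: "q mod n < n" using n by simp
        then show "(V *\<^sub>v x 0) $ q = unit_vec (r * n) p $ q"
          using block_difference_index[OF xt[OF x(1)] q, of 0] q p unfolding x(2) V_def by auto
      qed (use V in auto)
      moreover have "((\<lambda>t. (V *\<^sub>v x t) $ q) \<longlongrightarrow> 0) at_top" if q: "q < r * n" for q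
      proof -
        have i: "Suc (q div n) < Suc r" and j: "q mod n < n" using div_mod_less[OF q] by auto
        have "((\<lambda>t. x t $ (Suc (q div n) * n + q mod n) - x t $ (0 * n + q mod n)) \<longlongrightarrow> 0) at_top"
          using cs x(1) i j unfolding consensus_stable_def by blast
        moreover have "Suc (q div n) * n + q mod n = n + q" by simp
        ultimately have "((\<lambda>t. x t $ (n + q) - x t $ (q mod n)) \<longlongrightarrow> 0) at_top"
          by (simp only: mult_zero_left add_0_left)
        then show ?thesis using tendsto_cong[OF ev[OF x(1) q]] by simp
      qed
      ultimately show "\<exists>x. lti_solution M' x \<and> x 0 = unit_vec (r * n) p \<and> (\<forall>i<r * n. ((\<lambda>t. x t $ i) \<longlongrightarrow> 0) at_top)"
        using y[OF x(1)] by blast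
    qed
  qed
  then show ?thesis unfolding M_def M'_def .
qed

lemma det_kron_one:
  fixes P :: "'a :: idom mat"
  assumes P: "P \<in> carrier_mat n n"
  shows "Determinant.det (kron (1\<^sub>m r) P) = Determinant.det P ^ r"
proof -
  have "kron (1\<^sub>m r) (0\<^sub>m n n) + kron (1\<^sub>m r) P = kron (1\<^sub>m r) P"
    using P by (intro eq_matI) (auto simp: kron_def div_mod_less)
  moreover have "Determinant.det (kron (1\<^sub>m r) (0\<^sub>m n n) + kron (1\<^sub>m r) P) = (\<Prod>\<mu>\<leftarrow>diag_mat (1\<^sub>m r). Determinant.det (0\<^sub>m n n + \<mu> \<cdot>\<^sub>m P))"
    using P by (intro det_kron_pencil_upper_triangular) auto
  moreover have "diag_mat (1\<^sub>m r :: 'a mat) = replicate r 1"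
    by (auto simp: diag_mat_def list_eq_iff_nth_eq)
  moreover have "0\<^sub>m n n + 1 \<cdot>\<^sub>m P = P" using P by (intro eq_matI) auto
  ultimately show ?thesis by (simp add: prod_list_replicate)
qed

lemma order_prod_linear_factors:
  "Polynomial.order z (\<Prod>a\<leftarrow>as. [:- a, 1:]) = count_list as (z :: 'a :: field)"
proof (induction as)
  case (Cons a as)
  have nz: "(\<Prod>a\<leftarrow>as. [:- a, 1:]) \<noteq> (0 :: 'a poly)" by (auto simp: prod_list_zero_iff)
  have "Polynomial.order z [:- a, 1:] = (if a = z then 1 else 0)"
    using order_power_n_n[of z 1] by (auto intro: order_0I)
  then show ?case using Cons nz by (simp add: order_mult del: mult_pCons_left)
qed simp

text \<open>
  A minor of a product only selects rows of the first and columns of the last factor, so it is again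
  of the form treated by \<open>det_bordered\<close>.
\<close>

lemma submatrix_mult3:
  fixes R X S :: "'a :: comm_ring_1 mat"
  assumes R: "R \<in> carrier_mat p l" and X: "X \<in> carrier_mat l l" and S: "S \<in> carrier_mat l q"
    and I: "I \<subseteq> {..<p}" and J: "J \<subseteq> {..<q}"
  shows "submatrix (R * X * S) I J =
    Matrix.mat (card I) l (\<lambda>(i, j). R $$ (pick I i, j)) * X * Matrix.mat l (card J) (\<lambda>(i, j). S $$ (i, pick J j))"
    (is "?lhs = ?R * X * ?S")
proof (rule eq_matI)
  have cI: "{i. i < p \<and> i \<in> I} = I" and cJ: "{i. i < q \<and> i \<in> J} = J" using I J by auto
  show "dim_row ?lhs = dim_row (?R * X * ?S)" "dim_col ?lhs = dim_col (?R * X * ?S)"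
    using R S cI cJ by (auto simp: submatrix_def)
  fix i j assume "i < dim_row (?R * X * ?S)" "j < dim_col (?R * X * ?S)"
  then have i: "i < card I" and j: "j < card J" by auto
  have pi: "pick I i < p" and pj: "pick J j < q"
    using pick_in_set_le[OF i] pick_in_set_le[OF j] I J by auto
  have "?lhs $$ (i, j) = (R * X * S) $$ (pick I i, pick J j)"
    using R S cI cJ i j by (subst submatrix_index) auto
  also have "\<dots> = (\<Sum>b<l. (\<Sum>a<l. R $$ (pick I i, a) * X $$ (a, b)) * S $$ (b, pick J j))"
    using R X S pi pj by (simp add: scalar_prod_def lessThan_atLeast0 del: assoc_mult_mat)
  also have "\<dots> = (?R * X * ?S) $$ (i, j)"
    using X i j by (simp add: scalar_prod_def lessThan_atLeast0 del: assoc_mult_mat)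
  finally show "?lhs $$ (i, j) = (?R * X * ?S) $$ (i, j)" .
qed

lemma cmat_row_sum:
  assumes L: "L \<in> carrier_mat (Suc r) (Suc r)" and rows: "\<And>i. i < Suc r \<Longrightarrow> (\<Sum>k<Suc r. L $$ (i, k)) = 0"
    and i: "i < Suc r"
  shows "(\<Sum>k<Suc r. cmat L $$ (i, k)) = 0"
proof -
  have "(\<Sum>k<Suc r. cmat L $$ (i, k)) = of_real (\<Sum>k<Suc r. L $$ (i, k))"
    unfolding of_real_sum using L i by (intro sum.cong) auto
  then show ?thesis using rows[OF i] by (simp only: of_real_0)
qed

lemma char_poly_cmat_reduced_laplacian:
  assumes L: "L \<in> carrier_mat (Suc r) (Suc r)" and rows: "\<And>i. i < Suc r \<Longrightarrow> (\<Sum>k<Suc r. L $$ (i, k)) = 0"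
  shows "char_poly (cmat L) = [:0, 1:] * char_poly (cmat (reduced_laplacian L))"
proof -
  have "cmat (reduced_laplacian L) = reduced_laplacian (cmat L)"
    using L by (intro eq_matI) (auto simp: reduced_laplacian_def)
  moreover have "cmat L \<in> carrier_mat (Suc r) (Suc r)" using L by simp
  ultimately show ?thesis using char_poly_reduced_laplacian cmat_row_sum[OF L rows] by metis
qed

text \<open>
  The data of the closed loop with \<open>W = B K\<close> and with \<open>r + 1\<close> agents. The list \<open>ms\<close> collects the Laplacian
  eigenvalues \<open>\<lambda>\<^sub>2, \<dots>, \<lambda>\<^sub>N\<close> with multiplicity.
\<close>

locale network =
  fixes r n :: nat and L A W :: "real mat" and c :: real and ms :: "complex list"
  assumes L: "L \<in> carrier_mat (Suc r) (Suc r)"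
    and rows: "\<And>i. i < Suc r \<Longrightarrow> (\<Sum>k<Suc r. L $$ (i, k)) = 0"
    and A: "A \<in> carrier_mat n n" and W: "W \<in> carrier_mat n n"
    and ms: "char_poly (cmat (reduced_laplacian L)) = (\<Prod>\<mu>\<leftarrow>ms. [:- \<mu>, 1:])"
    and L_reg: "Determinant.det (reduced_laplacian L) \<noteq> 0"
    and AW: "hurwitz (cmat (A - W))"
    and c: "c \<noteq> 0"
begin

lemma dims [simp]:
  "dim_row A = n" "dim_col A = n" "dim_row W = n" "dim_col W = n" "dim_row L = Suc r" "dim_col L = Suc r"
  "dim_row (reduced_laplacian L) = r" "dim_col (reduced_laplacian L) = r"
  using carrier_matD[OF A] carrier_matD[OF W] carrier_matD[OF L] by (auto simp: reduced_laplacian_def)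

declare L [simp] A [simp] W [simp]

abbreviation "cA \<equiv> cmat A"
abbreviation "cW \<equiv> cmat W"
abbreviation "cL \<equiv> cmat L"
abbreviation "chi \<equiv> char_poly cA"

definition H :: "complex \<Rightarrow> complex mat" where
  "H s = mat_inv (s \<cdot>\<^sub>m 1\<^sub>m n - cA) * cW"

definition HL :: "complex \<Rightarrow> complex mat" where
  "HL s = kron (1\<^sub>m (Suc r)) (H s) * (of_real c \<cdot>\<^sub>m kron cL (1\<^sub>m n))"

lemma carriers [simp]:
  "cA \<in> carrier_mat n n" "cW \<in> carrier_mat n n" "cL \<in> carrier_mat (Suc r) (Suc r)"
  "s \<cdot>\<^sub>m 1\<^sub>m n - cA \<in> carrier_mat n n" "H s \<in> carrier_mat n n"
proof -
  show 1: "cA \<in> carrier_mat n n" "cW \<in> carrier_mat n n" "cL \<in> carrier_mat (Suc r) (Suc r)"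
    using A W L by auto
  show 2: "s \<cdot>\<^sub>m 1\<^sub>m n - cA \<in> carrier_mat n n" by (rule carrier_matI) auto
  show "H s \<in> carrier_mat n n" unfolding H_def using 1 2 mat_inv_carrier[OF 2] by auto
qed

lemma complex_rows: "i < Suc r \<Longrightarrow> (\<Sum>k<Suc r. cL $$ (i, k)) = 0"
  by (rule cmat_row_sum[OF L rows])

lemma length_ms: "length ms = r"
proof -
  have "cmat (reduced_laplacian L) \<in> carrier_mat r r" using L by auto
  from degree_monic_char_poly[OF this] show ?thesis
    unfolding ms using degree_linear_factors[of uminus ms] by simp
qed

lemma ms_nonzero: "\<mu> \<in> set ms \<Longrightarrow> \<mu> \<noteq> 0"
proof
  assume "\<mu> \<in> set ms" "\<mu> = 0"
  then have "poly (char_poly (cmat (reduced_laplacian L))) 0 = 0"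
    unfolding ms poly_prod_list by (auto simp: prod_list_zero_iff image_iff intro!: bexI[of _ 0])
  moreover have cr: "cmat (reduced_laplacian L) \<in> carrier_mat r r" using L by auto
  ultimately have "eigenvalue (cmat (reduced_laplacian L)) 0"
    using eigenvalue_root_char_poly by blast
  then have "Determinant.det (char_matrix (cmat (reduced_laplacian L)) 0) = 0" using eigenvalue_det[OF cr] by simp
  moreover have "char_matrix (cmat (reduced_laplacian L)) 0 = cmat (reduced_laplacian L)"
    using cr by (intro eq_matI) (auto simp: char_matrix_def)
  ultimately show False using L_reg by (simp add: of_real_hom.hom_det)
qed

lemma char_poly_network: "char_poly cL = (\<Prod>\<mu>\<leftarrow>0 # ms. [:- \<mu>, 1:])"
  using char_poly_cmat_reduced_laplacian[OF L rows] ms by simp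

lemma HL_eq: "HL s = of_real c \<cdot>\<^sub>m kron cL (H s)"
  unfolding HL_def
  by (subst mult_smult_distrib[of _ "Suc r * n" "Suc r * n" _ "Suc r * n"])
     (auto simp: kron_mult[of _ "Suc r" "Suc r" _ n n _ "Suc r" _ n] left_mult_one_mat[OF carriers(3)] right_mult_one_mat[OF carriers(5)]
       simp del: mult_Suc intro!: kron_carrier)

lemma HL_carrier [simp]: "HL s \<in> carrier_mat (Suc r * n) (Suc r * n)"
  unfolding HL_eq by (intro smult_carrier_mat kron_carrier) auto

lemma one_smult_loop: "1 \<cdot>\<^sub>m HL s = HL s"
  by (intro eq_matI) auto

lemma det_one_plus_loop:
  "Determinant.det (1\<^sub>m (Suc r * n) + t \<cdot>\<^sub>m HL s) = (\<Prod>\<mu>\<leftarrow>ms. Determinant.det (1\<^sub>m n + (t * of_real c * \<mu>) \<cdot>\<^sub>m H s))"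
proof -
  have "t \<cdot>\<^sub>m HL s = kron cL ((t * of_real c) \<cdot>\<^sub>m H s)"
    unfolding HL_eq kron_smult_right by (intro eq_matI) auto
  then have "Determinant.det (1\<^sub>m (Suc r * n) + t \<cdot>\<^sub>m HL s) = Determinant.det (kron (1\<^sub>m (Suc r)) (1\<^sub>m n) + kron cL ((t * of_real c) \<cdot>\<^sub>m H s))"
    by (simp only: kron_one)
  also have "\<dots> = (\<Prod>\<mu>\<leftarrow>0 # ms. Determinant.det (1\<^sub>m n + \<mu> \<cdot>\<^sub>m ((t * of_real c) \<cdot>\<^sub>m H s)))"
    by (rule det_kron_pencil[OF _ char_poly_network]) auto
  also have "\<dots> = (\<Prod>\<mu>\<leftarrow>0 # ms. Determinant.det (1\<^sub>m n + (t * of_real c * \<mu>) \<cdot>\<^sub>m H s))"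
  proof -
    have "\<mu> \<cdot>\<^sub>m ((t * of_real c) \<cdot>\<^sub>m H s) = (t * of_real c * \<mu>) \<cdot>\<^sub>m H s" for \<mu>
      by (intro eq_matI) auto
    then show ?thesis by (simp only:)
  qed
  moreover have "1\<^sub>m n + (t * of_real c * 0) \<cdot>\<^sub>m H s = 1\<^sub>m n"
    by (intro eq_matI) (auto simp: carrier_matD[OF carriers(5)])
  ultimately show ?thesis by simp
qed

text \<open>
  From \<open>(s I - A) H (s) = W\<close>.
\<close>

lemma det_return_difference:
  assumes "poly chi s \<noteq> 0"
  shows "Determinant.det (1\<^sub>m n + \<kappa> \<cdot>\<^sub>m H s) * poly chi s = Determinant.det (s \<cdot>\<^sub>m 1\<^sub>m n - cA + \<kappa> \<cdot>\<^sub>m cW)"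
proof -
  let ?S = "s \<cdot>\<^sub>m 1\<^sub>m n - cA"
  have d: "Determinant.det ?S = poly chi s" using poly_char_poly[OF carriers(1)] by simp
  have inv: "mat_inv ?S \<in> carrier_mat n n" "?S * mat_inv ?S = 1\<^sub>m n"
    using mat_inv_inverse[OF carriers(4)] assms d by auto
  have "?S * H s = cW"
    unfolding H_def using assoc_mult_mat[OF carriers(4) inv(1) carriers(2), symmetric] inv(2)
    by (simp add: left_mult_one_mat[OF carriers(2)])
  then have "?S * (1\<^sub>m n + \<kappa> \<cdot>\<^sub>m H s) = ?S + \<kappa> \<cdot>\<^sub>m cW"
    by (simp add: mult_add_distrib_mat[of _ n n _ n] mult_smult_distrib[of _ n n _ n])
  then have "Determinant.det (?S + \<kappa> \<cdot>\<^sub>m cW) = Determinant.det ?S * Determinant.det (1\<^sub>m n + \<kappa> \<cdot>\<^sub>m H s)"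
    by (metis det_mult carriers(4,5) add_carrier_mat one_carrier_mat smult_carrier_mat)
  then show ?thesis using d by simp
qed

text \<open>
  For \<open>r = 0\<close> both sides are 1 even where \<open>s I - A\<close> is singular.
\<close>

lemma det_one_plus_loop_rational:
  assumes "poly (chi ^ r) s \<noteq> 0"
  shows "Determinant.det (1\<^sub>m (Suc r * n) + t \<cdot>\<^sub>m HL s) =
    (\<Prod>\<mu>\<leftarrow>ms. Determinant.det (s \<cdot>\<^sub>m 1\<^sub>m n - cA + (t * of_real c * \<mu>) \<cdot>\<^sub>m cW)) / poly (chi ^ r) s"
proof -
  have "(\<Prod>\<mu>\<leftarrow>xs. Determinant.det (1\<^sub>m n + (t * of_real c * \<mu>) \<cdot>\<^sub>m H s)) * poly chi s ^ length xs =
    (\<Prod>\<mu>\<leftarrow>xs. Determinant.det (s \<cdot>\<^sub>m 1\<^sub>m n - cA + (t * of_real c * \<mu>) \<cdot>\<^sub>m cW))"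
    if "xs = [] \<or> poly chi s \<noteq> 0" for xs
    using that
  proof (induction xs)
    case (Cons \<mu> xs)
    then show ?case using det_return_difference[of s "t * of_real c * \<mu>", symmetric] by simp
  qed simp
  from this[of ms] have "Determinant.det (1\<^sub>m (Suc r * n) + t \<cdot>\<^sub>m HL s) * poly (chi ^ r) s =
    (\<Prod>\<mu>\<leftarrow>ms. Determinant.det (s \<cdot>\<^sub>m 1\<^sub>m n - cA + (t * of_real c * \<mu>) \<cdot>\<^sub>m cW))"
    using assms length_ms unfolding det_one_plus_loop by (cases "r = 0") (auto simp: poly_power)
  then show ?thesis by (rule iffD2[OF nonzero_eq_divide_eq[OF assms]])
qed

text \<open>
  The system matrix of the differences with agent 0.
\<close>

definition disagreement where
  "disagreement = cmat (kron (1\<^sub>m r) A - c \<cdot>\<^sub>m kron (reduced_laplacian L) W)"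

lemma disagreement_carrier [simp]: "disagreement \<in> carrier_mat (r * n) (r * n)"
  using kron_carrier[OF one_carrier_mat A, of r] kron_carrier[OF reduction_carrier(1)[OF L] W]
  by (auto simp: disagreement_def intro!: minus_carrier_mat smult_carrier_mat)

lemma det_disagreement:
  "Determinant.det (s \<cdot>\<^sub>m 1\<^sub>m (r * n) - disagreement) =
    (\<Prod>\<mu>\<leftarrow>ms. Determinant.det (s \<cdot>\<^sub>m 1\<^sub>m n - cA + (of_real c * \<mu>) \<cdot>\<^sub>m cW))"
proof -
  let ?B = "cmat (reduced_laplacian L)"
  have rL: "reduced_laplacian L \<in> carrier_mat r r" using L by simp
  have one: "(s \<cdot>\<^sub>m 1\<^sub>m (r * n)) = kron (1\<^sub>m r) (s \<cdot>\<^sub>m 1\<^sub>m n)"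
    unfolding kron_smult_right kron_one ..
  have "s \<cdot>\<^sub>m 1\<^sub>m (r * n) - disagreement = kron (1\<^sub>m r) (s \<cdot>\<^sub>m 1\<^sub>m n - cA) + kron ?B (of_real c \<cdot>\<^sub>m cW)"
    unfolding one disagreement_def using A W rL
    by (intro eq_matI) (auto simp: kron_def div_mod_less algebra_simps)
  also have "Determinant.det \<dots> = (\<Prod>\<mu>\<leftarrow>ms. Determinant.det (s \<cdot>\<^sub>m 1\<^sub>m n - cA + \<mu> \<cdot>\<^sub>m (of_real c \<cdot>\<^sub>m cW)))"
    by (rule det_kron_pencil[OF _ ms carriers(4)]) (use rL in auto)
  also have "\<dots> = (\<Prod>\<mu>\<leftarrow>ms. Determinant.det (s \<cdot>\<^sub>m 1\<^sub>m n - cA + (of_real c * \<mu>) \<cdot>\<^sub>m cW))"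
  proof -
    have "\<mu> \<cdot>\<^sub>m (of_real c \<cdot>\<^sub>m cW) = (of_real c * \<mu>) \<cdot>\<^sub>m cW" for \<mu>
      by (intro eq_matI) auto
    then show ?thesis by (simp only:)
  qed
  finally show ?thesis .
qed

lemma hurwitz_disagreement:
  "hurwitz disagreement \<longleftrightarrow> (\<forall>\<mu>\<in>set ms. hurwitz (cA - (of_real c * \<mu>) \<cdot>\<^sub>m cW))"
proof -
  have e: "s \<cdot>\<^sub>m 1\<^sub>m n - (cA - (of_real c * \<mu>) \<cdot>\<^sub>m cW) = s \<cdot>\<^sub>m 1\<^sub>m n - cA + (of_real c * \<mu>) \<cdot>\<^sub>m cW" for s \<mu>
    using A W by (intro eq_matI) auto
  have car: "cA - (of_real c * \<mu>) \<cdot>\<^sub>m cW \<in> carrier_mat n n" for \<mu> using A W by auto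
  have "hurwitz (cA - (of_real c * \<mu>) \<cdot>\<^sub>m cW) \<longleftrightarrow>
    (\<forall>s. Determinant.det (s \<cdot>\<^sub>m 1\<^sub>m n - cA + (of_real c * \<mu>) \<cdot>\<^sub>m cW) = 0 \<longrightarrow> Re s < 0)" for \<mu>
    unfolding hurwitz_iff_det[OF car] e ..
  then show ?thesis
    unfolding hurwitz_iff_det[OF disagreement_carrier] det_disagreement
    by (auto simp: prod_list_zero_iff image_iff)
qed

text \<open>
  By \<open>det_bordered\<close> with the state matrix \<open>I \<otimes> (s I - A)\<close> of \<open>r\<close> agents, obtained from the
  factorisation of \<open>L\<close> through dimension \<open>r\<close>. With a state matrix of \<open>r + 1\<close> agents the denominator would have one
  power of \<open>\<chi>\<close> too many.
\<close>

lemma minor_rational: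
  assumes I: "I \<subseteq> {..<Suc r * n}" and J: "J \<subseteq> {..<Suc r * n}" and card: "card I = card J"
  obtains u where "\<And>s. poly (chi ^ r) s \<noteq> 0 \<Longrightarrow>
    Determinant.det (submatrix (HL s) I J) = poly u s / poly (chi ^ r) s"
proof -
  let ?k = "card I" and ?l = "r * n" and ?m = "Suc r * n"
  let ?U = "kron (tail_columns cL) (1\<^sub>m n)" and ?V = "kron (difference_mat r) (of_real c \<cdot>\<^sub>m cW)"
  define R where "R = Matrix.mat ?k ?l (\<lambda>(i, j). ?U $$ (pick I i, j))"
  define S where "S = Matrix.mat ?l ?k (\<lambda>(i, j). ?V $$ (i, pick J j))"
  have R: "R \<in> carrier_mat ?k ?l" and S: "S \<in> carrier_mat ?l ?k" by (auto simp: R_def S_def)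
  note tc = reduction_carrier(2)[OF carriers(3)]
  have U: "?U \<in> carrier_mat ?m ?l" and V: "?V \<in> carrier_mat ?l ?m"
    by (intro kron_carrier tc one_carrier_mat reduction_carrier(3) smult_carrier_mat carriers)+
  have K: "kron (1\<^sub>m r) cA \<in> carrier_mat ?l ?l" by (intro kron_carrier one_carrier_mat carriers)
  let ?E = "four_block_mat (1\<^sub>m ?l) (0\<^sub>m ?l ?k) (0\<^sub>m ?k ?l) (0\<^sub>m ?k ?k) :: complex mat"
  let ?F = "four_block_mat (- kron (1\<^sub>m r) cA) S (- R) (0\<^sub>m ?k ?k)"
  have EF: "?E \<in> carrier_mat (?l + ?k) (?l + ?k)" "?F \<in> carrier_mat (?l + ?k) (?l + ?k)"
    using K by auto
  obtain u where u: "\<And>s. poly u s = Determinant.det (s \<cdot>\<^sub>m ?E + ?F)"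
    using det_affine_polynomial[OF EF] by blast
  show ?thesis
  proof (rule that)
    fix s assume s: "poly (chi ^ r) s \<noteq> 0"
    let ?S = "s \<cdot>\<^sub>m 1\<^sub>m n - cA"
    let ?M = "kron (1\<^sub>m r) ?S" and ?Mi = "kron (1\<^sub>m r) (mat_inv ?S)"
    have d: "Determinant.det ?S = poly chi s" using poly_char_poly[OF carriers(1)] by simp
    have inv: "mat_inv ?S \<in> carrier_mat n n" by (rule mat_inv_carrier[OF carriers(4)])
    have M: "?M \<in> carrier_mat ?l ?l" and Mi: "?Mi \<in> carrier_mat ?l ?l"
      by (intro kron_carrier one_carrier_mat inv carriers)+
    have MMi: "?M * ?Mi = 1\<^sub>m ?l"
    proof (cases "r = 0")
      case False
      then have "poly chi s \<noteq> 0" using s by (auto simp: poly_power)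
      then have "?S * mat_inv ?S = 1\<^sub>m n" using mat_inv_inverse(2)[OF carriers(4)] d by simp
      then show ?thesis
        using kron_mult[OF one_carrier_mat carriers(4) one_carrier_mat inv] by (simp add: kron_one)
    qed (auto intro!: eq_matI)
    have dM: "Determinant.det ?M = poly (chi ^ r) s"
      using det_kron_one[OF carriers(4)] d by (simp add: poly_power)
    have "HL s = ?U * ?Mi * ?V"
    proof -
      have "?U * ?Mi = kron (tail_columns cL) (mat_inv ?S)"
        using kron_mult[OF tc one_carrier_mat one_carrier_mat inv] tc inv by simp
      then have "?U * ?Mi * ?V = kron (tail_columns cL * difference_mat r) (mat_inv ?S * (of_real c \<cdot>\<^sub>m cW))"
        using kron_mult[OF tc inv reduction_carrier(3) smult_carrier_mat[OF carriers(2)]] by simp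
      also have "tail_columns cL * difference_mat r = cL"
        by (rule tail_columns_difference_mat[OF carriers(3) complex_rows])
      also have "mat_inv ?S * (of_real c \<cdot>\<^sub>m cW) = of_real c \<cdot>\<^sub>m H s"
        unfolding H_def by (rule mult_smult_distrib[OF inv carriers(2)])
      finally show ?thesis by (simp add: HL_eq kron_smult_right)
    qed
    then have sub: "submatrix (HL s) I J = R * ?Mi * S"
      using submatrix_mult3[OF U Mi V I J] card by (simp add: R_def S_def)
    have "s \<cdot>\<^sub>m ?E + ?F = four_block_mat ?M S (- R) (0\<^sub>m ?k ?k)"
    proof -
      have "?M = s \<cdot>\<^sub>m 1\<^sub>m ?l + - kron (1\<^sub>m r) cA"
        unfolding kron_one[symmetric] kron_smult_right[symmetric]
        using A by (intro eq_matI) (auto simp: kron_def div_mod_less algebra_simps)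
      then show ?thesis using R S K
        by (simp add: smult_four_block_mat[of _ ?l ?l _ ?k _ ?k] add_four_block_mat[of _ ?l ?l _ ?k _ ?k])
    qed
    then have "poly u s = poly (chi ^ r) s * Determinant.det (submatrix (HL s) I J)"
      unfolding u sub using det_bordered[OF M Mi MMi R S] dM by simp
    then show "Determinant.det (submatrix (HL s) I J) = poly u s / poly (chi ^ r) s"
      using s by (simp add: field_simps)
  qed
qed

lemma chi_nonzero: "chi ^ r \<noteq> 0"
  using degree_monic_char_poly[OF carriers(1)] by auto

text \<open>
  In \<open>\<tau>\<close>, \<open>det (z I - A + \<tau> W)\<close> is a polynomial that does not vanish at \<open>\<tau> = 1\<close>, because \<open>A - W\<close> is
  Hurwitz. So only finitely many \<open>t\<close> are excluded.
\<close>

lemma generic_gain: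
  assumes z: "Re z \<ge> 0"
  obtains t where "\<And>\<mu>. \<mu> \<in> set ms \<Longrightarrow> Determinant.det (z \<cdot>\<^sub>m 1\<^sub>m n - cA + (t * of_real c * \<mu>) \<cdot>\<^sub>m cW) \<noteq> 0"
proof -
  obtain w where w: "\<And>\<tau>. poly w \<tau> = Determinant.det (\<tau> \<cdot>\<^sub>m cW + (z \<cdot>\<^sub>m 1\<^sub>m n - cA))"
    using det_affine_polynomial[OF carriers(2,4)] by blast
  have sw: "\<tau> \<cdot>\<^sub>m cW + (z \<cdot>\<^sub>m 1\<^sub>m n - cA) = z \<cdot>\<^sub>m 1\<^sub>m n - cA + \<tau> \<cdot>\<^sub>m cW" for \<tau>
    by (rule comm_add_mat[of _ n n]) auto
  have "1 \<cdot>\<^sub>m cW + (z \<cdot>\<^sub>m 1\<^sub>m n - cA) = z \<cdot>\<^sub>m 1\<^sub>m n - cmat (A - W)"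
    using A W by (intro eq_matI) auto
  then have "poly w 1 \<noteq> 0"
    using AW z A W unfolding w by (subst (asm) hurwitz_iff_det[of _ n]) force+
  then have "finite {\<tau>. poly w \<tau> = 0}" by (intro poly_roots_finite) auto
  then have "finite (\<Union>\<mu>\<in>set ms. (\<lambda>\<tau>. \<tau> / (of_real c * \<mu>)) ` {\<tau>. poly w \<tau> = 0})" by auto
  then obtain t where t: "t \<notin> (\<Union>\<mu>\<in>set ms. (\<lambda>\<tau>. \<tau> / (of_real c * \<mu>)) ` {\<tau>. poly w \<tau> = 0})"
    using ex_new_if_finite[OF infinite_UNIV_char_0] by blast
  show ?thesis
  proof (rule that)
    fix \<mu> assume \<mu>: "\<mu> \<in> set ms"
    show "Determinant.det (z \<cdot>\<^sub>m 1\<^sub>m n - cA + (t * of_real c * \<mu>) \<cdot>\<^sub>m cW) \<noteq> 0"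
    proof
      assume "Determinant.det (z \<cdot>\<^sub>m 1\<^sub>m n - cA + (t * of_real c * \<mu>) \<cdot>\<^sub>m cW) = 0"
      then have "poly w (t * of_real c * \<mu>) = 0" by (simp add: w sw)
      moreover have "t = t * of_real c * \<mu> / (of_real c * \<mu>)" using c ms_nonzero[OF \<mu>] by simp
      ultimately show False using t \<mu> by blast
    qed
  qed
qed

text \<open>
  If all minors had smaller pole order, the numerators of the principal minors would all vanish at \<open>z\<close>,
  and with them the numerator of \<open>det (I + t HL)\<close> for every gain \<open>t\<close>, against \<open>generic_gain\<close>.
\<close>

lemma pole_mult_loop:
  assumes z: "Re z \<ge> 0"
  shows "pole_mult (Suc r * n) (Suc r * n) HL z = Polynomial.order z (chi ^ r)"
proof -
  let ?m = "Suc r * n"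
  define S where "S = {pole_order (\<lambda>s. Determinant.det (submatrix (HL s) I J)) z | I J.
    I \<subseteq> {..<?m} \<and> J \<subseteq> {..<?m} \<and> card I = card J}"
  have "S \<subseteq> (\<lambda>(I, J). pole_order (\<lambda>s. Determinant.det (submatrix (HL s) I J)) z) ` (Pow {..<?m} \<times> Pow {..<?m})"
    unfolding S_def by auto
  then have fin: "finite S" by (rule finite_subset) auto
  have "pole_order (\<lambda>s. Determinant.det (submatrix (HL s) {} {})) z \<in> S" unfolding S_def by blast
  then have ne: "S \<noteq> {}" by blast
  have pm: "pole_mult ?m ?m HL z = Max S" unfolding pole_mult_def S_def ..
  have "Max S \<le> Polynomial.order z (chi ^ r)"
  proof (rule Max.boundedI[OF fin ne])
    fix k assume "k \<in> S"
    then obtain I J where IJ: "I \<subseteq> {..<?m}" "J \<subseteq> {..<?m}" "card I = card J"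
      and k: "k = pole_order (\<lambda>s. Determinant.det (submatrix (HL s) I J)) z" unfolding S_def by blast
    obtain u where "\<And>s. poly (chi ^ r) s \<noteq> 0 \<Longrightarrow> Determinant.det (submatrix (HL s) I J) = poly u s / poly (chi ^ r) s"
      using minor_rational[OF IJ] by blast
    from pole_order_rational(1)[OF chi_nonzero this] show "k \<le> Polynomial.order z (chi ^ r)" unfolding k .
  qed
  moreover have "\<not> Max S < Polynomial.order z (chi ^ r)"
  proof
    assume less: "Max S < Polynomial.order z (chi ^ r)"
    have "\<exists>u. (\<forall>s. poly (chi ^ r) s \<noteq> 0 \<longrightarrow> Determinant.det (submatrix (HL s) I I) = poly u s / poly (chi ^ r) s) \<and> poly u z = 0"
      if I: "I \<subseteq> {..<?m}" for I
    proof -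
      obtain u where u: "\<And>s. poly (chi ^ r) s \<noteq> 0 \<Longrightarrow> Determinant.det (submatrix (HL s) I I) = poly u s / poly (chi ^ r) s"
        using minor_rational[OF I I refl] by blast
      have "pole_order (\<lambda>s. Determinant.det (submatrix (HL s) I I)) z \<in> S" unfolding S_def using I by blast
      then have "pole_order (\<lambda>s. Determinant.det (submatrix (HL s) I I)) z < Polynomial.order z (chi ^ r)"
        using Max_ge[OF fin] less by (meson le_less_trans)
      from pole_order_rational(2)[OF chi_nonzero u this] u show ?thesis by blast
    qed
    then obtain u where u: "\<And>I s. I \<subseteq> {..<?m} \<Longrightarrow> poly (chi ^ r) s \<noteq> 0 \<Longrightarrow>
        Determinant.det (submatrix (HL s) I I) = poly (u I) s / poly (chi ^ r) s"
      and uz: "\<And>I. I \<subseteq> {..<?m} \<Longrightarrow> poly (u I) z = 0" by metis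
    obtain t where t: "\<And>\<mu>. \<mu> \<in> set ms \<Longrightarrow> Determinant.det (z \<cdot>\<^sub>m 1\<^sub>m n - cA + (t * of_real c * \<mu>) \<cdot>\<^sub>m cW) \<noteq> 0"
      using generic_gain[OF z] by blast
    define p where "p = (\<Prod>\<mu>\<leftarrow>ms. char_poly (cA - (t * of_real c * \<mu>) \<cdot>\<^sub>m cW))"
    define q where "q = (\<Sum>I\<in>Pow {0..<?m}. [:t ^ card I:] * u I)"
    have pp: "poly p s = (\<Prod>\<mu>\<leftarrow>ms. Determinant.det (s \<cdot>\<^sub>m 1\<^sub>m n - cA + (t * of_real c * \<mu>) \<cdot>\<^sub>m cW))" for s
    proof -
      have "poly (char_poly (cA - \<kappa> \<cdot>\<^sub>m cW)) s = Determinant.det (s \<cdot>\<^sub>m 1\<^sub>m n - cA + \<kappa> \<cdot>\<^sub>m cW)" for \<kappa>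
      proof -
        have "cA - \<kappa> \<cdot>\<^sub>m cW \<in> carrier_mat n n" using A W by auto
        moreover have "s \<cdot>\<^sub>m 1\<^sub>m n - (cA - \<kappa> \<cdot>\<^sub>m cW) = s \<cdot>\<^sub>m 1\<^sub>m n - cA + \<kappa> \<cdot>\<^sub>m cW"
          using A W by (intro eq_matI) auto
        ultimately show ?thesis using poly_char_poly by metis
      qed
      then show ?thesis unfolding p_def poly_prod_list by (simp add: o_def)
    qed
    have "poly p s = poly q s" if s: "poly (chi ^ r) s \<noteq> 0" for s
    proof -
      have "poly p s / poly (chi ^ r) s = Determinant.det (1\<^sub>m ?m + t \<cdot>\<^sub>m HL s)"
        unfolding pp det_one_plus_loop_rational[OF s] ..
      also have "\<dots> = (\<Sum>I\<in>Pow {0..<?m}. t ^ card I * (poly (u I) s / poly (chi ^ r) s))"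
        unfolding det_one_plus_principal_minors[OF HL_carrier]
        by (intro sum.cong refl arg_cong2[of _ _ _ _ "(*)"] u s) auto
      also have "\<dots> = poly q s / poly (chi ^ r) s"
        by (simp add: q_def poly_sum sum_divide_distrib)
      finally show ?thesis using s divide_cancel_right by blast
    qed
    \<comment> \<open>\<open>p\<close> and \<open>q\<close> agree away from the finitely many poles, hence also at \<open>z\<close>\<close>
    then have "{s. poly (p - q) s \<noteq> 0} \<subseteq> {s. poly (chi ^ r) s = 0}"
      unfolding poly_diff right_minus_eq by blast
    then have "finite {s. poly (p - q) s \<noteq> 0}" using poly_roots_finite[OF chi_nonzero] finite_subset by blast
    moreover have "infinite (UNIV :: complex set)" by (rule infinite_UNIV_char_0)
    moreover have "UNIV = {s. poly (p - q) s \<noteq> 0} \<union> {s. poly (p - q) s = 0}" by auto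
    ultimately have "infinite {s. poly (p - q) s = 0}" by (metis finite_Un)
    then have "p - q = 0" using poly_roots_finite by blast
    then have "poly p z = poly q z" by simp
    also have "poly q z = 0" unfolding q_def poly_sum by (intro sum.neutral) (auto simp: uz lessThan_atLeast0)
    finally show False using t unfolding pp by (auto simp: prod_list_zero_iff)
  qed
  ultimately show ?thesis unfolding pm by simp
qed

theorem nyquist_network:
  fixes f :: "complex \<Rightarrow> complex"
  assumes f: "\<And>s. f s = Determinant.det (1\<^sub>m (Suc r * n) + HL s)"
  shows "nyquist_encircles {z \<in> tf_poles (Suc r * n) (Suc r * n) HL. Re z = 0} f
      (num_unstable_poles (Suc r * n) (Suc r * n) HL) \<longleftrightarrow> hurwitz disagreement"
proof -
  let ?m = "Suc r * n"
  obtain as where as: "chi = (\<Prod>a\<leftarrow>as. [:- a, 1:])"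
    using char_poly_factorized[OF carriers(1)] by blast
  obtain qs where qs: "char_poly disagreement = (\<Prod>a\<leftarrow>qs. [:- a, 1:])"
    using char_poly_factorized[OF disagreement_carrier] by blast
  define rs where "rs = concat (replicate r as)"
  have rs: "chi ^ r = (\<Prod>a\<leftarrow>rs. [:- a, 1:])"
  proof -
    have "(\<Prod>a\<leftarrow>concat (replicate k as). [:- a, 1:]) = (\<Prod>a\<leftarrow>as. [:- a, 1:]) ^ k" for k
      by (induction k) auto
    then show ?thesis unfolding rs_def as by simp
  qed
  have lin: "poly (\<Prod>a\<leftarrow>xs. [:- a, 1:]) s = (\<Prod>a\<leftarrow>xs. s - a)" for xs and s :: complex
    unfolding poly_prod_list by (simp add: o_def)
  have ord: "Polynomial.order z (chi ^ r) = count_list rs z" for z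
    unfolding rs by (rule order_prod_linear_factors)
  have poles: "z \<in> tf_poles ?m ?m HL \<longleftrightarrow> z \<in> set rs" if "Re z \<ge> 0" for z
    unfolding tf_poles_def using pole_mult_loop[OF that] ord[of z] count_list_0_iff[of rs z] by (metis mem_Collect_eq neq0_conv)
  have "num_unstable_poles ?m ?m HL = (\<Sum>z\<in>set (filter (\<lambda>z. Re z \<ge> 0) rs). count_list (filter (\<lambda>z. Re z \<ge> 0) rs) z)"
    unfolding num_unstable_poles_def
  proof (rule sum.cong)
    show "{z \<in> tf_poles ?m ?m HL. 0 \<le> Re z} = set (filter (\<lambda>z. 0 \<le> Re z) rs)" using poles by auto
    fix z assume "z \<in> set (filter (\<lambda>z. 0 \<le> Re z) rs)"
    then have "Re z \<ge> 0" by simp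
    moreover have "count_list (filter (\<lambda>z. 0 \<le> Re z) xs) z = count_list xs z" for xs
      using \<open>Re z \<ge> 0\<close> by (induction xs) auto
    ultimately show "pole_mult ?m ?m HL z = count_list (filter (\<lambda>z. 0 \<le> Re z) rs) z"
      using pole_mult_loop ord by simp
  qed
  then have k: "num_unstable_poles ?m ?m HL = length (filter (\<lambda>z. Re z \<ge> 0) rs)"
    by (simp add: sum_count_set)
  have P: "{z \<in> tf_poles ?m ?m HL. Re z = 0} = {z \<in> set rs. Re z = 0}" using poles by auto
  have fq: "f s = (\<Prod>z\<leftarrow>qs. s - z) / (\<Prod>z\<leftarrow>rs. s - z)" if "s \<notin> set rs" for s
  proof -
    have nz: "poly (chi ^ r) s \<noteq> 0" using that unfolding rs lin by (auto simp: prod_list_zero_iff)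
    have "f s = poly (char_poly disagreement) s / poly (chi ^ r) s"
      using det_one_plus_loop_rational[OF nz, of 1]
      unfolding f poly_char_poly[OF disagreement_carrier] det_disagreement one_smult_loop mult_1_left .
    then show ?thesis unfolding qs rs lin .
  qed
  have "nyquist_encircles {z \<in> set rs. Re z = 0} f (length (filter (\<lambda>z. Re z \<ge> 0) rs)) \<longleftrightarrow> (\<forall>z\<in>set qs. Re z < 0)"
    by (rule nyquist_criterion[OF fq refl refl])
  also have "\<dots> \<longleftrightarrow> hurwitz disagreement"
    unfolding hurwitz_def eigenvalue_root_char_poly[OF disagreement_carrier] qs lin
    by (auto simp: prod_list_zero_iff)
  finally show ?thesis unfolding P k .
qed

end

section \<open>The Nyquist criterion for consensus\<close>

theorem mainTheorem1:
  fixes N n m p\<^sub>u :: nat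
    and a :: "nat \<Rightarrow> nat \<Rightarrow> real"
    and A B K :: "real mat"
    and c :: real
    and lam :: "nat \<Rightarrow> complex"
  defines "L \<equiv> laplacian N a"
    and "H \<equiv> agent_tf A B K"
    and "HL \<equiv> loop_tf N a A B K c"
  defines "P \<equiv> {z \<in> tf_poles (N * n) (N * n) HL. Re z = 0}"
  assumes "n > 0" and "m > 0"
    and A: "A \<in> carrier_mat n n"
    and B: "B \<in> carrier_mat n m"
    and K: "K \<in> carrier_mat m n"
    and weights: "\<And>i k. i < N \<Longrightarrow> k < N \<Longrightarrow> a i k \<ge> 0"
    and graph: "strongly_connected (weight_digraph N a)"
    and tree: "has_directed_spanning_tree (weight_digraph N a)"
    and stab: "stabilizable A B"
    and AK: "hurwitz (cmat (A - B * K))"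
    and c: "c \<noteq> 0"
    and eigenvalues: "char_poly (cmat L) = (\<Prod>p = 1..N. [:- lam p, 1:])"
    and lam1: "lam 1 = 0"
    and p\<^sub>u: "num_unstable_poles (N * n) (N * n) HL = p\<^sub>u"
  shows "(consensus_stable N n (closed_loop N a A B K c) \<longleftrightarrow>
            (\<forall>p\<in>{2..N}. hurwitz (cmat A - (complex_of_real c * lam p) \<cdot>\<^sub>m cmat (B * K)))) \<and>
         (consensus_stable N n (closed_loop N a A B K c) \<longleftrightarrow>
            nyquist_encircles P (\<lambda>s. Determinant.det (1\<^sub>m (N * n) + HL s)) p\<^sub>u) \<and>
         (consensus_stable N n (closed_loop N a A B K c) \<longleftrightarrow>
            nyquist_encircles P
              (\<lambda>s. \<Prod>p = 2..N. Determinant.det (1\<^sub>m n + (complex_of_real c * lam p) \<cdot>\<^sub>m H s)) p\<^sub>u)"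
proof -
  obtain r where N: "N = Suc r"
    using graph by (cases N) (auto simp: strongly_connected_def weight_digraph_def)
  define ms where "ms = map lam [2..<Suc N]"
  have L: "L \<in> carrier_mat (Suc r) (Suc r)" by (simp add: L_def N)
  have rows: "(\<Sum>k<Suc r. L $$ (i, k)) = 0" if "i < Suc r" for i
    using laplacian_row_sum that unfolding L_def N by blast
  have W: "B * K \<in> carrier_mat n n" using B K by auto
  have prod_ms: "(\<Prod>p = 2..N. g (lam p)) = (\<Prod>\<mu>\<leftarrow>ms. g \<mu>)" for g :: "complex \<Rightarrow> 'b :: comm_monoid_mult"
    using prod.distinct_set_conv_list[of "[2..<Suc N]" "\<lambda>p. g (lam p)"]
    by (simp add: ms_def o_def atLeastLessThanSuc_atLeastAtMost del: upt_Suc)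
  have "[:0, 1:] * char_poly (cmat (reduced_laplacian L)) = [:0, 1:] * (\<Prod>\<mu>\<leftarrow>ms. [:- \<mu>, 1:])"
  proof -
    have "{1..N} = insert 1 {2..N}" using N by auto
    then have "(\<Prod>p = 1..N. [:- lam p, 1:]) = [:0, 1:] * (\<Prod>p = 2..N. [:- lam p, 1:])"
      using lam1 by simp
    then show ?thesis
      using eigenvalues char_poly_cmat_reduced_laplacian[OF L rows] prod_ms[of "\<lambda>\<mu>. [:- \<mu>, 1:]"] by (simp only:)
  qed
  then have ms: "char_poly (cmat (reduced_laplacian L)) = (\<Prod>\<mu>\<leftarrow>ms. [:- \<mu>, 1:])"
    by (subst (asm) mult_cancel_left) simp
  have reg: "Determinant.det (reduced_laplacian L) \<noteq> 0"
    using det_reduced_laplacian graph weights unfolding L_def N by blast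
  interpret net: network r n L A "B * K" c ms
    by unfold_locales (fact L rows A W ms reg AK c)+
  have H: "H = net.H"
    unfolding H_def agent_tf_def net.H_def using A by (intro ext) simp
  have HL: "HL = net.HL"
    unfolding HL_def loop_tf_def net.HL_def H[symmetric] H_def L_def[symmetric] using A by (intro ext) (simp add: N)
  have closed: "consensus_stable N n (closed_loop N a A B K c) \<longleftrightarrow> hurwitz net.disagreement"
  proof -
    have "closed_loop N a A B K c = kron (1\<^sub>m (Suc r)) A - c \<cdot>\<^sub>m kron L (B * K)"
      unfolding closed_loop_def L_def N ..
    then show ?thesis
      using consensus_iff_reduced_hurwitz[OF L rows A W, of c] unfolding net.disagreement_def N by (simp only:)
  qed
  have modes: "hurwitz net.disagreement \<longleftrightarrow>
      (\<forall>p\<in>{2..N}. hurwitz (cmat A - (complex_of_real c * lam p) \<cdot>\<^sub>m cmat (B * K)))"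
    unfolding net.hurwitz_disagreement ms_def by (auto simp: less_Suc_eq_le)
  have nyq: "nyquist_encircles P f p\<^sub>u \<longleftrightarrow> hurwitz net.disagreement"
    if "\<And>s. f s = Determinant.det (1\<^sub>m (Suc r * n) + net.HL s)" for f
    using net.nyquist_network[OF that] p\<^sub>u unfolding P_def HL N by simp
  have prod_form: "(\<Prod>p = 2..N. Determinant.det (1\<^sub>m n + (complex_of_real c * lam p) \<cdot>\<^sub>m H s)) =
      Determinant.det (1\<^sub>m (Suc r * n) + net.HL s)" for s
    using net.det_one_plus_loop[of 1 s] unfolding net.one_smult_loop mult_1_left H
    by (simp only: prod_ms[of "\<lambda>\<mu>. Determinant.det (1\<^sub>m n + (complex_of_real c * \<mu>) \<cdot>\<^sub>m net.H s)"])
  show ?thesis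
    unfolding closed using modes nyq[OF refl] nyq[OF prod_form] by (simp only: HL N)
qed

end
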